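(* Let $k,n\ge 0$ be integers with $k\le n-2$, and let $Z\in\mathrm{Mat}_{k+2,n}^{>0}$. Then $\tilde Z$ maps the cells $\mathcal C_{n,k,2}$ of $\mathrm{Gr}_{k,n}^{\ge0}$ injectively into the amplituhedron $\mathcal A_{n,k,2}(Z)$ (that is, $\tilde Z$ is injective on each cell in $\mathcal C_{n,k,2}$), and the images of distinct cells of $\mathcal C_{n,k,2}$ are pairwise disjoint.
   Context: $\mathrm{Gr}_{k,n}$ is the real Grassmannian of $k$-dimensional subspaces of $\mathbb R^n$ (row spans of $k\times n$ matrices); $\mathrm{Gr}_{k,n}^{\ge 0}$ is the set of $V$ representable by a matrix all of whose $k\times k$ minors are nonnegative. $[n]=\{1,\dots,n\}$. **Amplituhedron.** For $a\le b$, $\mathrm{Mat}_{a,b}^{>0}$ is the set of real $a\times b$ matrices with all $a\times a$ minors positive. For $Z\in\mathrm{Mat}_{k+m,n}^{>0}$ ($k+m\le n$), viewed as a linear map $\mathbb R^n\to\mathbb R^{k+m}$, the map $\tilde Z:\mathrm{Gr}_{k,n}^{\ge0}\to\mathrm{Gr}_{k,k+m}$ is $\tilde Z(V)=\{Z(v):v\in V\}$ (known to be well defined). The amplituhedron is $\mathcal A_{n,k,m}(Z)=\tilde Z(\mathrm{Gr}_{k,n}^{\ge0})$. **Decorated permutations and positroid cells.** A decorated permutation of $[n]$ is a permutation of $[n]$ with each fixed point colored black or white. For $V\in\mathrm{Gr}_{k,n}^{\ge 0}$ represented by a matrix with columns $v_1,\dots,v_n$, put $v_{j+n}=v_j$;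 the decorated permutation $\pi_V$ sends $i$ to the residue in $[n]$ mod $n$ of the smallest $j\ge i$ with $v_i\in\mathrm{span}(v_{i+1},\dots,v_j)$ (so $j=i$ iff $v_i=0$); a fixed point $i$ is black if $j=i$ and white if $j=i+n$. The positroid cell of $\pi$ is $S_\pi=\{V:\pi_V=\pi\}$. **The cells $\mathcal C_{n,k,2}$.** A plabic graph is a planar graph in a disk with boundary vertices $1,\dots,n$ in clockwise order, each incident to a single edge, and internal vertices colored black or white. Its permutation $\pi_G$: from boundary vertex $i$ follow edges, turning maximally right at black and maximally left at white internal vertices, ending at boundary vertex $\pi_G(i)$. For $1\le k'\le n-1$, let $\tilde{\mathcal G}_{n,k',2}$ be the set of the following plabic graphs: for $n=2$, the single edge joining boundary vertices $1$ and $2$; for $n\ge 3$, the graphs with internal vertices $v_1,\dots,v_{n-2}$ forming a path $v_1 - v_2-\cdots- v_{n-2}$, where each $v_j$ is joined to boundary vertex $j+1$, and in addition $v_1$ is joined to boundary vertex $1$ and $v_{n-2}$ is joined to boundary vertex $n$, with precisely $k'-1$ of the $v_j$ colored black and the rest white. Let $c_n$ be the $n$-cycle $n\mapsto n-1\mapsto\cdots\mapsto1\mapsto n$ (products composed right to left). Then $\Pi_{n,k,2}=\{c_n\pi_G:G\in\tilde{\mathcal G}_{n,k+1,2}\}$, with all fixed points colored black, and $\mathcal C_{n,k,2}=\{S_\pi:\pi\in\Pi_{n,k,2}\}$, a collection of cells of $\mathrm{Gr}_{k,n}^{\ge 0}$. *)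

theory Defs
  imports
    "Jordan_Normal_Form.VS_Connect"
    "Jordan_Normal_Form.DL_Submatrix"
    "Jordan_Normal_Form.Determinant"
    "HOL-Combinatorics.Cycles"
    "HOL-Library.Disjoint_Sets"
begin

section \<open>Grassmannians and the amplituhedron\<close>

text \<open>
  Vectors and matrices of variable size are those of the Jordan normal form development. Their
  entries are indexed from 0, whereas columns of matrices, boundary vertices of plabic graphs and
  arguments of permutations are numbered from 1 below, so that column \<open>i\<close> is \<open>col A (i - 1)\<close>.
\<close>

definition Gr :: "nat \<Rightarrow> nat \<Rightarrow> real vec set set" where
  "Gr k n = {V. VectorSpace.subspace class_ring V (module_vec TYPE(real) n) \<and>
     vectorspace.dim class_ring ((module_vec TYPE(real) n)\<lparr>carrier := V\<rparr>) = k}"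

text \<open>For \<open>V \<in> Gr k n\<close> such a matrix automatically has rank \<open>k\<close>.\<close>

definition represents :: "nat \<Rightarrow> nat \<Rightarrow> real mat \<Rightarrow> real vec set \<Rightarrow> bool" where
  "represents k n A V \<longleftrightarrow> A \<in> carrier_mat k n \<and> vec_space.row_space n A = V"

text \<open>The maximal minor of \<open>A\<close> on the columns in \<open>J\<close>, taken in increasing order; \<open>J\<close> is 0-based.\<close>

definition minor :: "real mat \<Rightarrow> nat set \<Rightarrow> real" where
  "minor A J = det (submatrix A UNIV J)"

definition Gr_nonneg :: "nat \<Rightarrow> nat \<Rightarrow> real vec set set" where
  "Gr_nonneg k n = {V \<in> Gr k n. \<exists>A. represents k n A V \<and>
     (\<forall>J \<subseteq> {..<n}. card J = k \<longrightarrow> minor A J \<ge> 0)}"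

definition Mat_pos :: "nat \<Rightarrow> nat \<Rightarrow> real mat set" where
  "Mat_pos a b = {A \<in> carrier_mat a b. \<forall>J \<subseteq> {..<b}. card J = a \<longrightarrow> minor A J > 0}"

definition Z_tilde :: "real mat \<Rightarrow> real vec set \<Rightarrow> real vec set" where
  "Z_tilde Z V = {Z *\<^sub>v v | v. v \<in> V}"

definition amplituhedron :: "nat \<Rightarrow> nat \<Rightarrow> nat \<Rightarrow> real mat \<Rightarrow> real vec set set" where
  "amplituhedron n k m Z = Z_tilde Z ` Gr_nonneg k n"


section \<open>Decorated permutations and positroid cells\<close>

datatype color = Black | White

text \<open>
  A permutation of \<open>{1..n}\<close> (the identity outside) together with a coloring whose domain is the
  set of fixed points in \<open>{1..n}\<close>.
\<close>

type_synonym decorated_perm = "(nat \<Rightarrow> nat) \<times> (nat \<Rightarrow> color option)"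

definition residue :: "nat \<Rightarrow> nat \<Rightarrow> nat" where
  "residue n j = (j - 1) mod n + 1"

text \<open>The column \<open>v\<^sub>j\<close>, for \<open>j \<ge> 1\<close>, with \<open>v\<^sub>j\<^sub>+\<^sub>n = v\<^sub>j\<close>.\<close>

definition ccol :: "nat \<Rightarrow> real mat \<Rightarrow> nat \<Rightarrow> real vec" where
  "ccol n A j = col A (residue n j - 1)"

text \<open>For \<open>j = i\<close> the spanning set is empty and the span is the zero subspace.\<close>

definition first_dep :: "nat \<Rightarrow> nat \<Rightarrow> real mat \<Rightarrow> nat \<Rightarrow> nat" where
  "first_dep k n A i = (LEAST j. i \<le> j \<and>
     ccol n A i \<in> LinearCombinations.module.span class_ring (module_vec TYPE(real) k) (ccol n A ` {i<..j}))"

definition dec_perm_mat :: "nat \<Rightarrow> nat \<Rightarrow> real mat \<Rightarrow> decorated_perm" where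
  "dec_perm_mat k n A =
     ((\<lambda>i. if i \<in> {1..n} then residue n (first_dep k n A i) else i),
      (\<lambda>i. if i \<in> {1..n} \<and> first_dep k n A i = i then Some Black
           else if i \<in> {1..n} \<and> first_dep k n A i = i + n then Some White
           else None))"

text \<open>
  Any two \<open>k \<times> n\<close> matrices representing \<open>V \<in> Gr k n\<close> differ by left multiplication with an
  invertible matrix, so the choice of the representative is immaterial.
\<close>

definition dec_perm :: "nat \<Rightarrow> nat \<Rightarrow> real vec set \<Rightarrow> decorated_perm" where
  "dec_perm k n V = dec_perm_mat k n (SOME A. represents k n A V)"

definition positroid_cell :: "nat \<Rightarrow> nat \<Rightarrow> decorated_perm \<Rightarrow> real vec set set" where
  "positroid_cell k n \<pi> = {V \<in> Gr_nonneg k n. dec_perm k n V = \<pi>}"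


section \<open>Plabic graphs and their trips\<close>

text \<open>
  The embedding of a plabic graph in the disk is recorded by its rotation system:
  \<open>nbrs G v\<close> lists the neighbors of the vertex \<open>v\<close> in clockwise order around \<open>v\<close>. The boundary
  vertices are \<open>Bdry 1, \<dots>, Bdry n\<close> in clockwise order around the disk, with \<open>n = bsize G\<close>, and
  each of them has a single neighbor.
\<close>

datatype vertex = Bdry nat | Intl nat

record plabic_graph =
  bsize :: nat
  intls :: "nat set"
  col_of :: "nat \<Rightarrow> color"
  nbrs :: "vertex \<Rightarrow> vertex list"

text \<open>
  A path entering an internal vertex \<open>v\<close> from its neighbor \<open>u\<close> turns maximally left by leaving along
  the edge that follows \<open>u\<close> in clockwise order around \<open>v\<close> (entering northwards, i.e. from the
  south, the next direction clockwise is west), and maximally right by leaving along the edge that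
  follows \<open>u\<close> in counterclockwise order.
\<close>

definition turn :: "plabic_graph \<Rightarrow> nat \<Rightarrow> vertex \<Rightarrow> vertex" where
  "turn G v u = (case col_of G v of
      White \<Rightarrow> cycle_of_list (nbrs G (Intl v)) u
    | Black \<Rightarrow> cycle_of_list (rev (nbrs G (Intl v))) u)"

text \<open>\<open>trip G i u v\<close>: the trip starting at \<open>Bdry i\<close> traverses the edge from \<open>u\<close> to \<open>v\<close>.\<close>

inductive trip :: "plabic_graph \<Rightarrow> nat \<Rightarrow> vertex \<Rightarrow> vertex \<Rightarrow> bool" for G i where
  start: "trip G i (Bdry i) (hd (nbrs G (Bdry i)))"
| step: "trip G i u (Intl v) \<Longrightarrow> v \<in> intls G \<Longrightarrow> trip G i (Intl v) (turn G v u)"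

definition trip_perm :: "plabic_graph \<Rightarrow> nat \<Rightarrow> nat" where
  "trip_perm G i =
     (if i \<in> {1..bsize G} then THE j. \<exists>u. trip G i u (Bdry j) else i)"


section \<open>The cells for \<open>m = 2\<close>\<close>

definition single_edge :: plabic_graph where
  "single_edge = \<lparr> bsize = 2, intls = {}, col_of = (\<lambda>_. White),
     nbrs = (\<lambda>v. if v = Bdry 1 then [Bdry 2] else if v = Bdry 2 then [Bdry 1] else []) \<rparr>"

text \<open>
  For \<open>n \<ge> 3\<close>. Picture the path of internal vertices from left to right, boundary vertex 1 at the
  left end, \<open>n\<close> at the right end and \<open>2, \<dots>, n - 1\<close> above the path from left to right. Clockwise
  around \<open>Intl j\<close> one then meets the neighbor above, the one to the right and the one to the left.
  The vertices in \<open>B\<close> are black.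
\<close>

definition caterpillar :: "nat \<Rightarrow> nat set \<Rightarrow> plabic_graph" where
  "caterpillar n B = \<lparr> bsize = n, intls = {1..n-2}, col_of = (\<lambda>j. if j \<in> B then Black else White),
     nbrs = (\<lambda>v. case v of
         Bdry i \<Rightarrow> if i = 1 then [Intl 1]
                   else if i = n then [Intl (n - 2)]
                   else if i \<in> {2..n-1} then [Intl (i - 1)] else []
       | Intl j \<Rightarrow> if j \<in> {1..n-2} then
            [Bdry (j + 1),
             if j = n - 2 then Bdry n else Intl (j + 1),
             if j = 1 then Bdry 1 else Intl (j - 1)] else []) \<rparr>"

text \<open>Meant for \<open>1 \<le> k' \<le> n - 1\<close>, so that \<open>k' = 1\<close> when \<open>n = 2\<close>.\<close>

definition G_tilde2 :: "nat \<Rightarrow> nat \<Rightarrow> plabic_graph set" where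
  "G_tilde2 n k' =
     (if n = 2 then {single_edge}
      else {caterpillar n B | B. B \<subseteq> {1..n-2} \<and> card B = k' - 1})"

text \<open>The cycle \<open>n \<mapsto> n - 1 \<mapsto> \<dots> \<mapsto> 1 \<mapsto> n\<close>.\<close>

definition long_cycle :: "nat \<Rightarrow> nat \<Rightarrow> nat" where
  "long_cycle n = cycle_of_list (rev [1..<n+1])"

definition black_decoration :: "nat \<Rightarrow> (nat \<Rightarrow> nat) \<Rightarrow> decorated_perm" where
  "black_decoration n p = (p, \<lambda>i. if i \<in> {1..n} \<and> p i = i then Some Black else None)"

definition Pi2 :: "nat \<Rightarrow> nat \<Rightarrow> decorated_perm set" where
  "Pi2 n k = {black_decoration n (long_cycle n \<circ> trip_perm G) | G. G \<in> G_tilde2 n (k + 1)}"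

definition cells2 :: "nat \<Rightarrow> nat \<Rightarrow> real vec set set set" where
  "cells2 n k = {positroid_cell k n \<pi> | \<pi>. \<pi> \<in> Pi2 n k}"

end

theory Submission
  imports Defs "Jordan_Normal_Form.DL_Rank"
begin

text \<open>
  A point of the cell of a caterpillar with set \<open>B\<close> of black vertices is spanned by rows \<open>r a\<close>,
  \<open>a \<in> B\<close>, supported on the (0-based) columns \<open>a - 1\<close>, \<open>a\<close> and \<open>n - 1\<close>, with positive entries at \<open>a - 1\<close>
  and \<open>a\<close>. Modulo its image \<open>Y\<close> this is a linear relation between \<open>z\<^sub>a\<^sub>-\<^sub>1\<close>, \<open>z\<^sub>a\<close> and \<open>z\<^sub>n\<^sub>-\<^sub>1\<close>, where \<open>z\<^sub>j\<close> is a
  column of \<open>Z\<close>. Expanding \<open>det (Y, z\<^sub>j, z\<^sub>n\<^sub>-\<^sub>1)\<close> multilinearly along the rows gives maximal minors of \<open>Z\<close> that all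
  occur with the same sign, so this determinant never vanishes, and it changes sign from \<open>j = a - 1\<close>
  to \<open>j = a\<close> exactly when \<open>a \<in> B\<close>. Hence \<open>Y\<close> determines \<open>B\<close>; and the relations modulo \<open>Y\<close> are unique
  up to scaling, so \<open>Y\<close> also determines the span of the rows.
\<close>

section \<open>Determinants of lists of columns\<close>

text \<open>The decorated permutation of a cell records only linear dependencies between columns, so
  the positivity of the rows has to be extracted separately. For an index outside \<open>B\<close>
  and the next index outside \<open>B\<close>, it says that the column at the former lies in the
  span of the columns strictly between the two, and no longer does so when the last of them is
  dropped; moreover no column is a coloop. These facts decide directly which Pluecker coordinates
  are nonzero at the two ends of a run of consecutive elements of \<open>B\<close>, and
  nonnegativity of the minors makes them positive. Inside a long run they say nothing directly;
  there the sign with which the apex column enters has to be used. A cell is shown to be contained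
  in the set of spans of such rows; injectivity and disjointness pass to subsets.\<close>

definition cdet :: "real vec list \<Rightarrow> real" where
  "cdet vs = det (mat_of_cols (length vs) vs)"

lemma pick_eq_sorted_list_of_set:
  assumes "finite J" "i < card J"
  shows "pick J i = sorted_list_of_set J ! i"
proof -
  have *: "sorted_list_of_set J = map (pick J) [0..<card J]"
  proof (rule sorted_distinct_set_unique)
    have mono: "pick J a < pick J b" if "a < b" "b < card J" for a b
      using pick_mono_le[OF that(2,1)] .
    show "sorted (map (pick J) [0..<card J])"
      by (auto simp: sorted_iff_nth_mono_less intro: less_imp_le mono)
    have "inj_on (pick J) {0..<card J}"
      by (rule inj_onI) (metis atLeastLessThan_iff linorder_neqE_nat mono nat_less_le)
    thus "distinct (map (pick J) [0..<card J])" by (simp add: distinct_map)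
    moreover have "pick J ` {0..<card J} \<subseteq> J" using pick_in_set_le by auto
    moreover have "card (pick J ` {0..<card J}) = card J"
      using card_image[OF \<open>inj_on (pick J) {0..<card J}\<close>] by simp
    ultimately have "pick J ` {0..<card J} = J"
      using assms(1) by (intro card_subset_eq)
    thus "set (sorted_list_of_set J) = set (map (pick J) [0..<card J])"
      using assms(1) by (subst set_sorted_list_of_set) auto
  qed (use assms in auto)
  show ?thesis unfolding * using assms by simp
qed

lemma minor_eq_cdet:
  assumes A: "A \<in> carrier_mat k n" and J: "J \<subseteq> {..<n}" "card J = k"
  shows "minor A J = cdet (map (col A) (sorted_list_of_set J))"
proof -
  have fin: "finite J" using J finite_subset by auto
  have id: "{j. j < n \<and> j \<in> J} = J" using J by auto
  have len: "length (sorted_list_of_set J) = k" using J by simp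
  have nth: "sorted_list_of_set J ! j \<in> J" if "j < k" for j
    using nth_mem[of j "sorted_list_of_set J"] that fin J(2) by simp
  have "submatrix A UNIV J = mat_of_cols k (map (col A) (sorted_list_of_set J))"
  proof (rule eq_matI)
    fix i j assume "i < dim_row (mat_of_cols k (map (col A) (sorted_list_of_set J)))"
      "j < dim_col (mat_of_cols k (map (col A) (sorted_list_of_set J)))"
    hence ij: "i < k" "j < k" using len by (auto simp: mat_of_cols_carrier)
    have "submatrix A UNIV J $$ (i, j) = A $$ (i, pick J j)"
      using submatrix_index[of i A UNIV j J] ij A J id by (simp add: pick_UNIV)
    moreover have "sorted_list_of_set J ! j < n" using nth[OF ij(2)] J by auto
    ultimately show "submatrix A UNIV J $$ (i, j)
        = mat_of_cols k (map (col A) (sorted_list_of_set J)) $$ (i, j)"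
      using pick_eq_sorted_list_of_set[OF fin] ij A len J(2)
      by (simp add: mat_of_cols_index)
  qed (use A J id len in \<open>auto simp: dim_submatrix mat_of_cols_carrier\<close>)
  thus ?thesis unfolding minor_def cdet_def by (simp add: J)
qed

text \<open>The deleted column is the only one that contains \<open>x\<close>, so the cofactors
  along this slot are constants.\<close>

lemma mat_delete_slot:
  "mat_delete (mat_of_cols N (xs @ [x] @ ys)) i (length xs)
   = mat_delete (mat_of_cols N (xs @ [x'] @ ys)) i (length xs)"
proof (rule eq_matI)
  fix p q
  assume *: "p < dim_row (mat_delete (mat_of_cols N (xs @ [x'] @ ys)) i (length xs))"
    "q < dim_col (mat_delete (mat_of_cols N (xs @ [x'] @ ys)) i (length xs))"
  then show "mat_delete (mat_of_cols N (xs @ [x] @ ys)) i (length xs) $$ (p, q)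
      = mat_delete (mat_of_cols N (xs @ [x'] @ ys)) i (length xs) $$ (p, q)"
    unfolding mat_delete_def mat_of_cols_def by (auto simp: nth_append nth_Cons')
qed (auto simp: mat_delete_def mat_of_cols_def)

text \<open>Laplace expansion along the free column; \<open>w\<close> is the vector of cofactors.
  All functionals on the target space, and all explicit rows of a point of the Grassmannian, arise
  in this way.\<close>

lemma cdet_functional:
  assumes N: "N = Suc (length xs + length ys)"
  obtains w where "w \<in> carrier_vec N"
    "\<And>x. x \<in> carrier_vec N \<Longrightarrow> cdet (xs @ [x] @ ys) = w \<bullet> x"
proof
  let ?M = "\<lambda>x. mat_of_cols N (xs @ [x] @ ys)"
  \<comment> \<open>\<open>undefined\<close> is a mere filler: the cofactors do not see what stands
    in this slot.\<close>
  let ?w = "vec N (\<lambda>i. cofactor (?M undefined) i (length xs))"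
  show "?w \<in> carrier_vec N" by simp
  fix x :: "real vec" assume x: "x \<in> carrier_vec N"
  have "cdet (xs @ [x] @ ys) = det (?M x)" unfolding cdet_def by (simp add: N)
  also have "\<dots> = (\<Sum>i<N. ?M x $$ (i, length xs) * cofactor (?M x) i (length xs))"
    by (rule laplace_expansion_column) (auto simp: N mat_of_cols_def)
  also have "\<dots> = (\<Sum>i<N. x $ i * cofactor (?M undefined) i (length xs))"
    unfolding cofactor_def mat_delete_slot[of N xs x ys _ undefined]
    by (rule sum.cong) (auto simp: mat_of_cols_def N)
  also have "\<dots> = ?w \<bullet> x" using x
    by (auto simp: scalar_prod_def mult.commute lessThan_atLeast0 intro!: sum.cong)
  finally show "cdet (xs @ [x] @ ys) = ?w \<bullet> x" .
qed

lemma cdet_not_distinct: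
  assumes "\<not> distinct vs" "set vs \<subseteq> carrier_vec (length vs)"
  shows "cdet vs = 0"
proof -
  obtain i j where "i < length vs" "j < length vs" "i \<noteq> j" "vs ! i = vs ! j"
    using assms(1) by (auto simp: distinct_conv_nth)
  moreover have "vs ! i \<in> carrier_vec (length vs)" "vs ! j \<in> carrier_vec (length vs)"
    using assms(2) calculation by auto
  ultimately show ?thesis unfolding cdet_def
    by (intro det_identical_columns[of _ "length vs" i j]) (auto)
qed

lemma cdet_swap_adjacent:
  assumes "set (xs @ [u, v] @ ys) \<subseteq> carrier_vec N" "N = length (xs @ [u, v] @ ys)"
  shows "cdet (xs @ [u, v] @ ys) = - cdet (xs @ [v, u] @ ys)"
proof -
  let ?k = "length xs"
  let ?A = "mat_of_cols N (xs @ [v, u] @ ys)"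
  have "det (swapcols ?k (Suc ?k) ?A) = - det ?A"
    by (rule det_swapcols[of _ N]) (auto simp: assms(2))
  moreover have "swapcols ?k (Suc ?k) ?A = mat_of_cols N (xs @ [u, v] @ ys)"
    by (rule eq_matI) (auto simp: mat_of_cols_def nth_append nth_Cons' assms(2))
  ultimately show ?thesis unfolding cdet_def by (simp add: assms(2))
qed

text \<open>One sign for each adjacent swap. This sign later separates the apex entries of two
  competing rows.\<close>

lemma cdet_move_to_end:
  assumes "set (xs @ [v] @ ys) \<subseteq> carrier_vec N" "N = length (xs @ [v] @ ys)"
  shows "cdet (xs @ [v] @ ys) = (-1) ^ length ys * cdet (xs @ ys @ [v])"
  using assms
proof (induction ys arbitrary: xs)
  case (Cons u ys)
  have "cdet (xs @ [v] @ u # ys) = - cdet ((xs @ [u]) @ [v] @ ys)"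
    using cdet_swap_adjacent[of xs v u ys N] Cons.prems by simp
  also have "cdet ((xs @ [u]) @ [v] @ ys) = (-1) ^ length ys * cdet ((xs @ [u]) @ ys @ [v])"
    by (rule Cons.IH) (use Cons.prems in auto)
  finally show ?case by simp
qed simp

text \<open>A kernel vector of the transposed matrix. It turns a vanishing Pluecker coordinate into
  a nonzero row that vanishes on the columns concerned.\<close>

lemma cdet_eq_0_imp_annihilator:
  assumes vs: "set vs \<subseteq> carrier_vec (length vs)" and "cdet vs = 0"
  obtains y where "y \<in> carrier_vec (length vs)" "y \<noteq> 0\<^sub>v (length vs)"
    "\<And>v. v \<in> set vs \<Longrightarrow> y \<bullet> v = 0"
proof -
  let ?M = "mat_of_cols (length vs) vs"
  have "det ?M\<^sup>T = 0" using assms(2) unfolding cdet_def by (subst det_transpose) auto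
  then obtain y where y: "y \<in> carrier_vec (length vs)" "y \<noteq> 0\<^sub>v (length vs)"
    "?M\<^sup>T *\<^sub>v y = 0\<^sub>v (length vs)"
    using det_0_iff_vec_prod_zero[of "?M\<^sup>T" "length vs"] by auto
  have "y \<bullet> v = 0" if v_in: "v \<in> set vs" for v
  proof -
    obtain i where i: "i < length vs" "v = vs ! i" using v_in by (metis in_set_conv_nth)
    have v: "v \<in> carrier_vec (length vs)" using vs v_in by auto
    have "row ?M\<^sup>T i = v" using i v by (subst row_transpose) auto
    moreover have "(?M\<^sup>T *\<^sub>v y) $ i = 0" using y(3) i by simp
    ultimately have "v \<bullet> y = 0" using i by simp
    thus ?thesis using comm_scalar_prod[OF v y(1)] by simp
  qed
  thus ?thesis using that y by blast
qed

section \<open>Images of fan-shaped row spaces\<close>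

text \<open>The indices are kept in the tuple so that sortedness of a whole chain can be stated. A
  single column \<open>z j\<close> fits in as \<open>(1, j, 0, j, 0)\<close>.\<close>

definition comb :: "(nat \<Rightarrow> real vec) \<Rightarrow> nat \<Rightarrow> real \<times> nat \<times> real \<times> nat \<times> real \<Rightarrow> real vec" where
  "comb z l = (\<lambda>(\<alpha>, p, \<beta>, q, \<gamma>). \<alpha> \<cdot>\<^sub>v z p + \<beta> \<cdot>\<^sub>v z q + \<gamma> \<cdot>\<^sub>v z l)"

abbreviation ends :: "real \<times> nat \<times> real \<times> nat \<times> real \<Rightarrow> nat list" where
  "ends \<equiv> \<lambda>(\<alpha>, p, \<beta>, q, \<gamma>). [p, q]"

context
  fixes z :: "nat \<Rightarrow> real vec" and N l :: nat
  assumes z_carrier: "\<And>j. z j \<in> carrier_vec N"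
    and pos: "\<And>ps. \<lbrakk>sorted ps; distinct ps; length ps = N; \<forall>p \<in> set ps. p \<le> l\<rbrakk> \<Longrightarrow> cdet (map z ps) > 0"
begin

lemma comb_carrier: "comb z l it \<in> carrier_vec N"
  unfolding comb_def using z_carrier by (auto split: prod.splits)

text \<open>The \<gamma> term has \<open>z l\<close> both in this slot and at the end, so its
  determinant is zero and two terms remain.\<close>

lemma comb_slot:
  assumes N: "length ps + length its + 2 = N"
  shows "cdet (map z ps @ map (comb z l) ((\<alpha>, p, \<beta>, q, \<gamma>) # its) @ [z l])
    = \<alpha> * cdet (map z (ps @ [p]) @ map (comb z l) its @ [z l])
    + \<beta> * cdet (map z (ps @ [q]) @ map (comb z l) its @ [z l])"
proof -
  let ?ys = "map (comb z l) its @ [z l]"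
  obtain w where w: "w \<in> carrier_vec N"
    "\<And>x. x \<in> carrier_vec N \<Longrightarrow> cdet (map z ps @ [x] @ ?ys) = w \<bullet> x"
    using cdet_functional[of N "map z ps" ?ys] N by auto
  have "cdet (map z ps @ [z l] @ ?ys) = 0"
    by (rule cdet_not_distinct) (use N z_carrier comb_carrier in auto)
  hence l: "w \<bullet> z l = 0" using w(2)[OF z_carrier] by simp
  have "w \<bullet> comb z l (\<alpha>, p, \<beta>, q, \<gamma>) = \<alpha> * (w \<bullet> z p) + \<beta> * (w \<bullet> z q) + \<gamma> * (w \<bullet> z l)"
    unfolding comb_def
    using w(1) z_carrier by (simp add: scalar_prod_add_distrib[of _ N])
  thus ?thesis using w(2)[OF comb_carrier, of "(\<alpha>, p, \<beta>, q, \<gamma>)"] w(2)[OF z_carrier, of p] w(2)[OF z_carrier, of q] l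
    by simp
qed

text \<open>Slots are expanded from left to right, and \<open>ps\<close> collects the indices chosen
  so far. Since the pairs do not cross, every choice gives a weakly increasing list: either a column
  is repeated and the term is zero, or the term is a positive minor with a nonnegative coefficient.
  Hence nothing can cancel.\<close>

lemma cdet_chain_nonneg:
  assumes "length ps + length its + 1 = N"
    and "sorted (ps @ concat (map ends its) @ [l])"
    and "\<forall>(\<alpha>, p, \<beta>, q, \<gamma>) \<in> set its. 0 \<le> \<alpha> \<and> 0 \<le> \<beta>"
  shows "0 \<le> cdet (map z ps @ map (comb z l) its @ [z l])"
  using assms
proof (induction its arbitrary: ps)
  case Nil
  show ?case
  proof (cases "distinct (ps @ [l])")
    case True
    thus ?thesis using pos[of "ps @ [l]"] Nil by (auto simp: sorted_append)
  next
    case False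
    hence "\<not> distinct (map z (ps @ [l]))" using distinct_map by blast
    hence "cdet (map z (ps @ [l])) = 0" using Nil z_carrier by (intro cdet_not_distinct) auto
    thus ?thesis by simp
  qed
next
  case (Cons it its)
  obtain \<alpha> p \<beta> q \<gamma> where it: "it = (\<alpha>, p, \<beta>, q, \<gamma>)" by (metis prod_cases5)
  have "0 \<le> cdet (map z (ps @ [p]) @ map (comb z l) its @ [z l])"
    by (rule Cons.IH) (use Cons.prems it in \<open>auto simp: sorted_append\<close>)
  moreover have "0 \<le> cdet (map z (ps @ [q]) @ map (comb z l) its @ [z l])"
    by (rule Cons.IH) (use Cons.prems it in \<open>auto simp: sorted_append\<close>)
  moreover have "0 \<le> \<alpha>" "0 \<le> \<beta>" using Cons.prems(3) it by auto
  ultimately show ?case unfolding it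
    by (subst comb_slot) (use Cons.prems it in auto)
qed

text \<open>\<open>cs\<close> singles out one term of the expansion: a strictly increasing choice of
  indices with positive coefficients. All other terms are nonnegative.\<close>

lemma cdet_chain_pos:
  assumes "length ps + length its + 1 = N"
    and "sorted (ps @ concat (map ends its) @ [l])"
    and "\<forall>(\<alpha>, p, \<beta>, q, \<gamma>) \<in> set its. 0 \<le> \<alpha> \<and> 0 \<le> \<beta>"
    and "sorted (ps @ cs @ [l])" "distinct (ps @ cs @ [l])"
    and "list_all2 (\<lambda>(\<alpha>, p, \<beta>, q, \<gamma>) c. c = p \<and> 0 < \<alpha> \<or> c = q \<and> 0 < \<beta>) its cs"
  shows "0 < cdet (map z ps @ map (comb z l) its @ [z l])"
  using assms
proof (induction its arbitrary: ps cs)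
  case Nil
  thus ?case using pos[of "ps @ [l]"] by (auto simp: sorted_append)
next
  case (Cons it its)
  obtain \<alpha> p \<beta> q \<gamma> where it: "it = (\<alpha>, p, \<beta>, q, \<gamma>)" by (metis prod_cases5)
  obtain c cs' where cs: "cs = c # cs'" "c = p \<and> 0 < \<alpha> \<or> c = q \<and> 0 < \<beta>"
    and all2: "list_all2 (\<lambda>(\<alpha>, p, \<beta>, q, \<gamma>) c. c = p \<and> 0 < \<alpha> \<or> c = q \<and> 0 < \<beta>) its cs'"
    using Cons.prems(6) it by (auto simp: list_all2_Cons1)
  have ab: "0 \<le> \<alpha>" "0 \<le> \<beta>" using Cons.prems(3) it by auto
  have np: "0 \<le> cdet (map z (ps @ [p]) @ map (comb z l) its @ [z l])"
    by (rule cdet_chain_nonneg) (use Cons.prems it in \<open>auto simp: sorted_append\<close>)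
  have nq: "0 \<le> cdet (map z (ps @ [q]) @ map (comb z l) its @ [z l])"
    by (rule cdet_chain_nonneg) (use Cons.prems it in \<open>auto simp: sorted_append\<close>)
  have c: "0 < cdet (map z (ps @ [c]) @ map (comb z l) its @ [z l])"
  proof (rule Cons.IH[where cs = cs'])
    show "sorted ((ps @ [c]) @ concat (map ends its) @ [l])"
      using Cons.prems(2) it cs(2) by (auto simp: sorted_append)
  qed (use Cons.prems it cs all2 in auto)
  from cs(2) have "0 < \<alpha> * cdet (map z (ps @ [p]) @ map (comb z l) its @ [z l])
      + \<beta> * cdet (map z (ps @ [q]) @ map (comb z l) its @ [z l])"
  proof
    assume "c = p \<and> 0 < \<alpha>"
    thus ?thesis using c nq ab by (intro add_pos_nonneg) auto
  next
    assume "c = q \<and> 0 < \<beta>"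
    thus ?thesis using c np ab by (intro add_nonneg_pos) auto
  qed
  thus ?case unfolding it by (subst comb_slot) (use Cons.prems it in auto)
qed

end

section \<open>Functionals that vanish on the image of a point\<close>

lemma Mat_pos_cdet:
  assumes "Z \<in> Mat_pos N n" "sorted ps" "distinct ps" "length ps = N" "\<forall>p \<in> set ps. p < n"
  shows "cdet (map (col Z) ps) > 0"
proof -
  have "sorted_list_of_set (set ps) = ps" using assms by (simp add: sorted_list_of_set.idem_if_sorted_distinct)
  moreover have "set ps \<subseteq> {..<n}" "card (set ps) = N"
    using assms distinct_card by auto
  ultimately show ?thesis using assms(1) minor_eq_cdet[of Z N n "set ps"] unfolding Mat_pos_def by auto
qed

text \<open>Columns are 0-based here, so \<open>n - 1\<close> is the apex of the fan triangulation dual to the caterpillar.\<close>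

definition fan_rows :: "nat \<Rightarrow> nat set \<Rightarrow> (nat \<Rightarrow> real vec) \<Rightarrow> bool" where
  "fan_rows n B r \<longleftrightarrow> B \<subseteq> {1..<n - 1} \<and> (\<forall>a \<in> B. r a \<in> carrier_vec n \<and> 0 < r a $ (a - 1) \<and> 0 < r a $ a \<and>
     (\<forall>i < n - 1. i \<noteq> a - 1 \<longrightarrow> i \<noteq> a \<longrightarrow> r a $ i = 0))"

definition row_combs :: "nat \<Rightarrow> nat set \<Rightarrow> (nat \<Rightarrow> real vec) \<Rightarrow> real vec set" where
  "row_combs n B r = {vec n (\<lambda>i. \<Sum>a\<in>B. c a * r a $ i) | c. True}"

lemma fan_sum:
  fixes g :: "nat \<Rightarrow> real"
  assumes "fan_rows n B r" "a \<in> B"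
  shows "(\<Sum>i<n. g i * r a $ i) = g (a - 1) * r a $ (a - 1) + g a * r a $ a + g (n - 1) * r a $ (n - 1)"
proof -
  have a: "1 \<le> a" "a < n - 1" using assms unfolding fan_rows_def by auto
  have "(\<Sum>i<n. g i * r a $ i) = (\<Sum>i \<in> {a - 1, a, n - 1}. g i * r a $ i)"
    by (rule sum.mono_neutral_right) (use assms a in \<open>auto simp: fan_rows_def\<close>)
  also have "\<dots> = g (a - 1) * r a $ (a - 1) + g a * r a $ a + g (n - 1) * r a $ (n - 1)"
  proof -
    have "a - 1 \<notin> {a, n - 1}" "a \<notin> {n - 1}" using a by auto
    thus ?thesis by simp
  qed
  finally show ?thesis .
qed

lemma scalar_prod_mult_mat_vec:
  fixes Z :: "real mat"
  assumes "Z \<in> carrier_mat N n" "w \<in> carrier_vec N" "v \<in> carrier_vec n"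
  shows "w \<bullet> (Z *\<^sub>v v) = (\<Sum>i<n. (w \<bullet> col Z i) * v $ i)"
proof -
  have "w \<bullet> (Z *\<^sub>v v) = (Z\<^sup>T *\<^sub>v w) \<bullet> v"
    using assms by (metis transpose_vec_mult_scalar comm_scalar_prod mult_mat_vec_carrier transpose_carrier_mat)
  also have "\<dots> = (\<Sum>i<n. (w \<bullet> col Z i) * v $ i)"
    using assms by (auto simp: scalar_prod_def[of "Z\<^sup>T *\<^sub>v w"] lessThan_atLeast0
      comm_scalar_prod[of w N] intro!: sum.cong)
  finally show ?thesis .
qed

lemma fan_mult_mat_vec:
  assumes "Z \<in> carrier_mat N n" "fan_rows n B r" "a \<in> B"
  shows "Z *\<^sub>v r a = comb (col Z) (n - 1) (r a $ (a - 1), a - 1, r a $ a, a, r a $ (n - 1))"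
proof (rule eq_vecI)
  fix i assume "i < dim_vec (comb (col Z) (n - 1) (r a $ (a - 1), a - 1, r a $ a, a, r a $ (n - 1)))"
  hence i: "i < N" using assms(1) by (simp add: comb_def)
  have a: "1 \<le> a" "a < n - 1" "dim_vec (r a) = n" using assms unfolding fan_rows_def by auto
  have "(Z *\<^sub>v r a) $ i = (\<Sum>j<n. Z $$ (i, j) * r a $ j)"
    using assms(1) i a by (auto simp: scalar_prod_def lessThan_atLeast0 intro!: sum.cong)
  also have "\<dots> = comb (col Z) (n - 1) (r a $ (a - 1), a - 1, r a $ a, a, r a $ (n - 1)) $ i"
    unfolding fan_sum[OF assms(2,3)] using assms(1) i a by (simp add: comb_def mult.commute)
  finally show "(Z *\<^sub>v r a) $ i = comb (col Z) (n - 1) (r a $ (a - 1), a - 1, r a $ a, a, r a $ (n - 1)) $ i" .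
qed (use assms in \<open>simp add: comb_def\<close>)

text \<open>From \<open>b < c\<close> follows \<open>b \<le> c - 1\<close>: neighboring pairs may
  share an index but never cross.\<close>

lemma sorted_pairs:
  fixes bs :: "nat list"
  assumes "sorted bs" "distinct bs"
  shows "sorted (concat (map (\<lambda>b. [b - 1, b]) bs))"
  using assms
proof (induction bs)
  case (Cons b bs)
  have "b \<le> c - 1 \<and> b - 1 \<le> c - 1 \<and> b - 1 \<le> c \<and> b \<le> c" if "c \<in> set bs" for c
  proof -
    have "b \<le> c" "b \<noteq> c" using Cons.prems that by auto
    thus ?thesis by linarith
  qed
  thus ?case using Cons by (auto simp: sorted_append)
qed simp

lemma card_split_le:
  fixes B :: "nat set"
  assumes "finite B"
  shows "card {b \<in> B. b \<le> c} + card {b \<in> B. c < b} = card B"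
proof -
  have "{b \<in> B. b \<le> c} \<union> {b \<in> B. c < b} = B" by auto
  thus ?thesis using assms by (subst card_Un_disjoint[symmetric]) auto
qed

text \<open>By \<open>le\<close> and \<open>gt\<close> the pairs of the elements up to
  \<open>c\<close> end at or before \<open>j\<close> and the other pairs begin at or after
  \<open>j\<close>, so the chain with \<open>j\<close> inserted is sorted. The cut \<open>c\<close>
  is separate from \<open>j\<close> so that one and the same determinant can be evaluated at several
  \<open>j\<close>.\<close>

lemma fan_cdet_pos:
  assumes Z: "Z \<in> Mat_pos (k + 2) n" and r: "fan_rows n B r" and k: "card B = k" and j: "j < n - 1"
    and le: "\<And>b. b \<in> B \<Longrightarrow> b \<le> c \<Longrightarrow> b \<le> j" and gt: "\<And>b. b \<in> B \<Longrightarrow> c < b \<Longrightarrow> j < b"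
  shows "0 < cdet (map (\<lambda>b. Z *\<^sub>v r b) (sorted_list_of_set {b \<in> B. b \<le> c}) @ [col Z j]
    @ map (\<lambda>b. Z *\<^sub>v r b) (sorted_list_of_set {b \<in> B. c < b}) @ [col Z (n - 1)])"
proof -
  let ?lo = "sorted_list_of_set {b \<in> B. b \<le> c}" and ?hi = "sorted_list_of_set {b \<in> B. c < b}"
  let ?it = "\<lambda>b. (r b $ (b - 1), b - 1, r b $ b, b, r b $ (n - 1))"
  let ?its = "map ?it ?lo @ [(1, j, 0, j, 0)] @ map ?it ?hi"
  have B: "B \<subseteq> {1..<n - 1}" and fin: "finite B"
    using r finite_subset unfolding fan_rows_def by auto
  have setlo: "set ?lo = {b \<in> B. b \<le> c}" and sethi: "set ?hi = {b \<in> B. c < b}" using fin by auto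
  have ZC: "Z \<in> carrier_mat (k + 2) n" using Z unfolding Mat_pos_def by auto
  have len: "length ?lo + length ?hi = k" using card_split_le[OF fin] k by simp
  have cc: "concat (map ends (map ?it bs)) = concat (map (\<lambda>b. [b - 1, b]) bs)" for bs
    by (induction bs) auto
  have jcol: "comb (col Z) (n - 1) (1, j, 0, j, 0) = col Z j"
    unfolding comb_def using ZC by auto
  have A: "0 < cdet (map (col Z) [] @ map (comb (col Z) (n - 1)) ?its @ [col Z (n - 1)])"
  \<comment> \<open>The smaller index of every pair before \<open>j\<close> and the larger index of
    every pair after it avoid \<open>j\<close> and make the choice strictly increasing.\<close>
  proof (rule cdet_chain_pos[where cs = "map (\<lambda>b. b - 1) ?lo @ [j] @ ?hi" and N = "k + 2"])
    show "col Z i \<in> carrier_vec (k + 2)" for i by (metis ZC carrier_matD(1) col_dim)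
    show "0 < cdet (map (col Z) ps)" if "sorted ps" "distinct ps" "length ps = k + 2" "\<forall>p\<in>set ps. p \<le> n - 1" for ps
      using Mat_pos_cdet[OF Z that(1-3)] that(4) j by fastforce
    show "length [] + length ?its + 1 = k + 2" using len by simp
    show "sorted ([] @ concat (map ends ?its) @ [n - 1])"
      using sorted_pairs[of ?lo] sorted_pairs[of ?hi] le gt B j fin
      unfolding map_append concat_append cc
      by (auto simp: sorted_append) fastforce+
    show "\<forall>(\<alpha>, p, \<beta>, q, \<gamma>) \<in> set ?its. 0 \<le> \<alpha> \<and> 0 \<le> \<beta>"
      using r unfolding fan_rows_def by (auto simp: fin less_imp_le)
    have "sorted_wrt (<) (map (\<lambda>b. b - 1) ?lo)"
      unfolding sorted_wrt_map
      by (rule sorted_wrt_mono_rel[OF _ strict_sorted_list_of_set]) (use fin B in \<open>auto intro!: diff_less_mono\<close>)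
    moreover have "sorted_wrt (<) ?hi" by simp
    ultimately have "sorted_wrt (<) ([] @ (map (\<lambda>b. b - 1) ?lo @ [j] @ ?hi) @ [n - 1])"
      using le gt B j fin by (fastforce simp: sorted_wrt_append)
    thus "sorted ([] @ (map (\<lambda>b. b - 1) ?lo @ [j] @ ?hi) @ [n - 1])"
      "distinct ([] @ (map (\<lambda>b. b - 1) ?lo @ [j] @ ?hi) @ [n - 1])"
      using strict_sorted_iff by blast+
    show "list_all2 (\<lambda>(\<alpha>, p, \<beta>, q, \<gamma>) c. c = p \<and> 0 < \<alpha> \<or> c = q \<and> 0 < \<beta>) ?its (map (\<lambda>b. b - 1) ?lo @ [j] @ ?hi)"
      using r fin unfolding fan_rows_def
      by (intro list_all2_appendI) (auto simp: list_all2_map1 list_all2_map2 list_all2_same)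
  qed
  have *: "map (comb (col Z) (n - 1)) (map ?it bs) = map (\<lambda>b. Z *\<^sub>v r b) bs" if "set bs \<subseteq> B" for bs
    using fan_mult_mat_vec[OF ZC r] that by auto
  have its: "map (comb (col Z) (n - 1)) ?its
      = map (\<lambda>b. Z *\<^sub>v r b) ?lo @ [col Z j] @ map (\<lambda>b. Z *\<^sub>v r b) ?hi"
    unfolding map_append using *[of ?lo] *[of ?hi] jcol setlo sethi by auto
  show ?thesis using A unfolding its by simp
qed

text \<open>The functional is the determinant in the previous lemma as a function of the vector in the slot of \<open>col Z j\<close>.\<close>

lemma fan_separating_functional:
  assumes Z: "Z \<in> Mat_pos (k + 2) n" and r: "fan_rows n B r" and k: "card B = k"
  obtains w where "w \<in> carrier_vec (k + 2)" "\<And>b. b \<in> B \<Longrightarrow> w \<bullet> (Z *\<^sub>v r b) = 0"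
    "w \<bullet> col Z (n - 1) = 0"
    "\<And>j. \<lbrakk>j < n - 1; \<And>b. b \<in> B \<Longrightarrow> b \<le> c \<Longrightarrow> b \<le> j; \<And>b. b \<in> B \<Longrightarrow> c < b \<Longrightarrow> j < b\<rbrakk>
      \<Longrightarrow> 0 < w \<bullet> col Z j"
proof -
  let ?f = "\<lambda>b. Z *\<^sub>v r b"
  let ?xs = "map ?f (sorted_list_of_set {b \<in> B. b \<le> c})"
  let ?ys = "map ?f (sorted_list_of_set {b \<in> B. c < b}) @ [col Z (n - 1)]"
  have fin: "finite B" using r finite_subset unfolding fan_rows_def by auto
  have len: "length ?xs + length ?ys = k + 1"
    using card_split_le[OF fin, of c] k by simp
  have ZC: "Z \<in> carrier_mat (k + 2) n" using Z unfolding Mat_pos_def by auto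
  have cv: "?f b \<in> carrier_vec (k + 2)" "col Z j \<in> carrier_vec (k + 2)" for b j
    by (rule carrier_vecI, use ZC in simp)+
  have N: "k + 2 = Suc (length ?xs + length ?ys)" using len by simp
  obtain w where w: "w \<in> carrier_vec (k + 2)"
    "\<And>x. x \<in> carrier_vec (k + 2) \<Longrightarrow> cdet (?xs @ [x] @ ?ys) = w \<bullet> x"
    using cdet_functional[OF N] by blast
  have vanish: "w \<bullet> x = 0" if "x \<in> set (?xs @ ?ys)" for x
  proof -
    have x: "x \<in> carrier_vec (k + 2)" using that cv by auto
    have "cdet (?xs @ [x] @ ?ys) = 0"
      by (rule cdet_not_distinct) (use that cv x len in auto)
    thus ?thesis using w(2)[OF x] by simp
  qed
  show ?thesis
  proof
    show "w \<bullet> ?f b = 0" if "b \<in> B" for b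
      by (rule vanish) (use that fin not_le in \<open>auto simp: image_iff\<close>)
    show "0 < w \<bullet> col Z j" if "j < n - 1" "\<And>b. b \<in> B \<Longrightarrow> b \<le> c \<Longrightarrow> b \<le> j" "\<And>b. b \<in> B \<Longrightarrow> c < b \<Longrightarrow> j < b" for j
      using fan_cdet_pos[where c = c, OF Z r k that] w(2)[OF cv(2), of j] by simp
  qed (use w vanish in auto)
qed

text \<open>Here the free slot is the last one, and \<open>col Z a\<close> fills the slot in the
  middle. The separating functional vanishes on the apex column and so cannot see the apex entry of
  a row; this one can.\<close>

lemma fan_apex_functional:
  assumes Z: "Z \<in> Mat_pos (k + 2) n" and r: "fan_rows n B r" and k: "card B = k" and a: "a \<in> B"
  obtains w where "w \<in> carrier_vec (k + 2)" "\<And>b. b \<in> B \<Longrightarrow> w \<bullet> (Z *\<^sub>v r b) = 0"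
    "0 < w \<bullet> col Z (n - 1)"
proof -
  let ?f = "\<lambda>b. Z *\<^sub>v r b"
  let ?xs = "map ?f (sorted_list_of_set {b \<in> B. b \<le> a}) @ [col Z a] @ map ?f (sorted_list_of_set {b \<in> B. a < b})"
  have fin: "finite B" and an: "a < n - 1" using r a finite_subset unfolding fan_rows_def by auto
  have len: "length ?xs = k + 1"
    using card_split_le[OF fin, of a] k by simp
  have ZC: "Z \<in> carrier_mat (k + 2) n" using Z unfolding Mat_pos_def by auto
  have cv: "?f b \<in> carrier_vec (k + 2)" "col Z j \<in> carrier_vec (k + 2)" for b j
    by (rule carrier_vecI, use ZC in simp)+
  have N: "k + 2 = Suc (length ?xs + length ([] :: real vec list))" using len by simp
  obtain w where w: "w \<in> carrier_vec (k + 2)"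
    "\<And>x. x \<in> carrier_vec (k + 2) \<Longrightarrow> cdet (?xs @ [x] @ []) = w \<bullet> x"
    using cdet_functional[OF N] by blast
  have vanish: "w \<bullet> x = 0" if "x \<in> set ?xs" for x
  proof -
    have x: "x \<in> carrier_vec (k + 2)" using that cv by auto
    have "cdet (?xs @ [x] @ []) = 0"
      by (rule cdet_not_distinct) (use that cv x len in auto)
    thus ?thesis using w(2)[OF x] by simp
  qed
  show ?thesis
  proof
    show "w \<bullet> ?f b = 0" if "b \<in> B" for b
      by (rule vanish) (use that fin not_le in \<open>auto simp: image_iff\<close>)
    show "0 < w \<bullet> col Z (n - 1)"
      using fan_cdet_pos[OF Z r k an, of a] w(2)[OF cv(2), of "n - 1"] by simp
  qed (use w in auto)
qed

lemma row_combs_mem: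
  assumes "fan_rows n B r" "a \<in> B"
  shows "r a \<in> row_combs n B r"
proof -
  have fin: "finite B" and ra: "r a \<in> carrier_vec n"
    using assms finite_subset unfolding fan_rows_def by auto
  have "(\<Sum>b\<in>B. (if b = a then 1 else 0) * r b $ i) = r a $ i" for i
  proof -
    have "(\<Sum>b\<in>B. (if b = a then 1 else 0) * r b $ i) = (\<Sum>b\<in>B. if b = a then r b $ i else 0)"
      by (rule sum.cong) auto
    thus ?thesis using fin assms(2) by simp
  qed
  hence "r a = vec n (\<lambda>i. \<Sum>b\<in>B. (if b = a then 1 else 0) * r b $ i)" using ra by auto
  thus ?thesis unfolding row_combs_def by (intro CollectI exI[of _ "\<lambda>b. if b = a then 1 else 0"]) simp
qed

lemma functional_vanishes_on_image:
  assumes Z: "Z \<in> carrier_mat N n" and w: "w \<in> carrier_vec N" and r: "fan_rows n B r"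
    and 0: "\<And>b. b \<in> B \<Longrightarrow> w \<bullet> (Z *\<^sub>v r b) = 0" and x: "x \<in> Z_tilde Z (row_combs n B r)"
  shows "w \<bullet> x = 0"
proof -
  obtain c where xc: "x = Z *\<^sub>v vec n (\<lambda>i. \<Sum>a\<in>B. c a * r a $ i)"
    using x unfolding Z_tilde_def row_combs_def by auto
  have "w \<bullet> x = (\<Sum>i<n. (w \<bullet> col Z i) * (\<Sum>a\<in>B. c a * r a $ i))"
    unfolding xc by (subst scalar_prod_mult_mat_vec[OF Z w]) auto
  also have "\<dots> = (\<Sum>a\<in>B. c a * (\<Sum>i<n. (w \<bullet> col Z i) * r a $ i))"
    unfolding sum_distrib_left by (subst sum.swap) (simp add: mult.left_commute)
  also have "\<dots> = (\<Sum>a\<in>B. c a * (w \<bullet> (Z *\<^sub>v r a)))"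
    using r unfolding fan_rows_def by (intro sum.cong) (auto simp: scalar_prod_mult_mat_vec[OF Z w])
  finally show ?thesis using 0 by simp
qed

lemma fan_scalar_prod:
  assumes "Z \<in> carrier_mat N n" "w \<in> carrier_vec N" "fan_rows n B r" "a \<in> B"
  shows "w \<bullet> (Z *\<^sub>v r a) = (w \<bullet> col Z (a - 1)) * r a $ (a - 1) + (w \<bullet> col Z a) * r a $ a
    + (w \<bullet> col Z (n - 1)) * r a $ (n - 1)"
  using assms scalar_prod_mult_mat_vec[OF assms(1,2), of "r a"] fan_sum[OF assms(3,4), of "\<lambda>i. w \<bullet> col Z i"]
  unfolding fan_rows_def by auto

lemma fan_subset_if_images_eq:
  assumes Z: "Z \<in> Mat_pos (k + 2) n"
    and r: "fan_rows n B r" "card B = k" and r': "fan_rows n B' r'"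
    and eq: "Z_tilde Z (row_combs n B r) = Z_tilde Z (row_combs n B' r')"
  shows "B' \<subseteq> B"
proof
  fix a assume a: "a \<in> B'"
  have ZC: "Z \<in> carrier_mat (k + 2) n" using Z unfolding Mat_pos_def by auto
  have an: "1 \<le> a" "a < n - 1" using r' a unfolding fan_rows_def by auto
  show "a \<in> B"
  proof (rule ccontr)
    assume aB: "a \<notin> B"
    obtain w where w: "w \<in> carrier_vec (k + 2)" "\<And>b. b \<in> B \<Longrightarrow> w \<bullet> (Z *\<^sub>v r b) = 0"
      "w \<bullet> col Z (n - 1) = 0"
      "\<And>j. \<lbrakk>j < n - 1; \<And>b. b \<in> B \<Longrightarrow> b \<le> a \<Longrightarrow> b \<le> j; \<And>b. b \<in> B \<Longrightarrow> a < b \<Longrightarrow> j < b\<rbrakk>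
        \<Longrightarrow> 0 < w \<bullet> col Z j"
      using fan_separating_functional[OF Z r] by blast
    have "0 < w \<bullet> col Z (a - 1)"
    proof (rule w(4))
      fix b assume "b \<in> B" "b \<le> a"
      moreover have "b \<noteq> a" using aB \<open>b \<in> B\<close> by auto
      ultimately show "b \<le> a - 1" by linarith
    qed (use an in auto)
    moreover have "0 < w \<bullet> col Z a" by (rule w(4)) (use an in auto)
    moreover have "0 < r' a $ (a - 1)" "0 < r' a $ a" using r' a unfolding fan_rows_def by auto
    ultimately have "0 < w \<bullet> (Z *\<^sub>v r' a)"
      unfolding fan_scalar_prod[OF ZC w(1) r' a] w(3) by (simp add: add_pos_pos)
    moreover have "Z *\<^sub>v r' a \<in> Z_tilde Z (row_combs n B r)"
      unfolding eq using row_combs_mem[OF r' a] unfolding Z_tilde_def by auto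
    hence "w \<bullet> (Z *\<^sub>v r' a) = 0"
      using functional_vanishes_on_image[OF ZC w(1) r(1) w(2)] by blast
    ultimately show False by simp
  qed
qed

lemma cross_multiply:
  fixes g h a b c d :: real
  assumes "g * a + h * b = 0" "g * c + h * d = 0"
  shows "g * (c * b) = g * (a * d)"
proof -
  have "g * (c * b) - g * (a * d) = (g * c + h * d) * b - (g * a + h * b) * d"
    by (simp add: algebra_simps)
  thus ?thesis using assms by simp
qed

text \<open>Every \<open>r' a\<close> is a multiple of \<open>r a\<close>. The functional cut at
  \<open>a\<close> ignores the apex and fixes the ratio of the entries at \<open>a - 1\<close> and
  \<open>a\<close>; the apex functional then fixes the third entry.\<close>

lemma row_combs_subset_if_images_eq:
  assumes Z: "Z \<in> Mat_pos (k + 2) n"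
    and r: "fan_rows n B r" "card B = k" and r': "fan_rows n B r'"
    and eq: "Z_tilde Z (row_combs n B r) = Z_tilde Z (row_combs n B r')"
  shows "row_combs n B r' \<subseteq> row_combs n B r"
proof -
  have ZC: "Z \<in> carrier_mat (k + 2) n" using Z unfolding Mat_pos_def by auto
  have "\<exists>s. r' a = s \<cdot>\<^sub>v r a" if a: "a \<in> B" for a
  proof -
    have an: "1 \<le> a" "a < n - 1" using r a unfolding fan_rows_def by auto
    have im: "Z *\<^sub>v r' a \<in> Z_tilde Z (row_combs n B r)"
      unfolding eq using row_combs_mem[OF r' a] unfolding Z_tilde_def by auto
    have p: "0 < r a $ (a - 1)" "0 < r a $ a" "0 < r' a $ (a - 1)" "0 < r' a $ a"
      and c: "dim_vec (r a) = n" "dim_vec (r' a) = n"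
      and z: "\<And>i. i < n - 1 \<Longrightarrow> i \<noteq> a - 1 \<Longrightarrow> i \<noteq> a \<Longrightarrow> r a $ i = 0 \<and> r' a $ i = 0"
      using r r' a unfolding fan_rows_def by auto
    define s where "s = r' a $ a / r a $ a"
    obtain w where w: "w \<in> carrier_vec (k + 2)" "\<And>b. b \<in> B \<Longrightarrow> w \<bullet> (Z *\<^sub>v r b) = 0"
      "w \<bullet> col Z (n - 1) = 0"
      "\<And>j. \<lbrakk>j < n - 1; \<And>b. b \<in> B \<Longrightarrow> b \<le> a \<Longrightarrow> b \<le> j; \<And>b. b \<in> B \<Longrightarrow> a < b \<Longrightarrow> j < b\<rbrakk>
        \<Longrightarrow> 0 < w \<bullet> col Z j"
      using fan_separating_functional[OF Z r] by blast
    let ?g = "\<lambda>i. w \<bullet> col Z i"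
    have ga: "0 < ?g a" by (rule w(4)) (use an in auto)
    have e1: "?g (a - 1) * r a $ (a - 1) + ?g a * r a $ a = 0"
      using w(2)[OF a] fan_scalar_prod[OF ZC w(1) r(1) a] w(3) by simp
    have e2: "?g (a - 1) * r' a $ (a - 1) + ?g a * r' a $ a = 0"
      using functional_vanishes_on_image[OF ZC w(1) r(1) w(2) im] fan_scalar_prod[OF ZC w(1) r' a] w(3) by simp
    \<comment> \<open>In \<open>e1\<close> the second summand is positive, so
      \<open>?g (a - 1)\<close> is in fact negative: this is the sign change at an element of
      \<open>B\<close>.\<close>
    have "?g (a - 1) \<noteq> 0" using e1 ga p by auto
    moreover have "?g (a - 1) * (r' a $ (a - 1) * r a $ a) = ?g (a - 1) * (r a $ (a - 1) * r' a $ a)"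
      using cross_multiply[OF e1 e2] .
    ultimately have s1: "r' a $ (a - 1) = s * r a $ (a - 1)"
      using p unfolding s_def by (simp add: field_simps)
    have s2: "r' a $ a = s * r a $ a" using p unfolding s_def by simp
    obtain v where v: "v \<in> carrier_vec (k + 2)" "\<And>b. b \<in> B \<Longrightarrow> v \<bullet> (Z *\<^sub>v r b) = 0"
      "0 < v \<bullet> col Z (n - 1)"
      using fan_apex_functional[OF Z r a] by blast
    let ?h = "\<lambda>i. v \<bullet> col Z i"
    have f1: "?h (a - 1) * r a $ (a - 1) + ?h a * r a $ a + ?h (n - 1) * r a $ (n - 1) = 0"
      using v(2)[OF a] fan_scalar_prod[OF ZC v(1) r(1) a] by simp
    have f2: "?h (a - 1) * r' a $ (a - 1) + ?h a * r' a $ a + ?h (n - 1) * r' a $ (n - 1) = 0"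
      using functional_vanishes_on_image[OF ZC v(1) r(1) v(2) im] fan_scalar_prod[OF ZC v(1) r' a] by simp
    have "?h (n - 1) * (r' a $ (n - 1) - s * r a $ (n - 1))
      = (?h (a - 1) * r' a $ (a - 1) + ?h a * r' a $ a + ?h (n - 1) * r' a $ (n - 1))
        - s * (?h (a - 1) * r a $ (a - 1) + ?h a * r a $ a + ?h (n - 1) * r a $ (n - 1))"
      unfolding s1 s2 by (simp only: algebra_simps)
    hence "?h (n - 1) * (r' a $ (n - 1) - s * r a $ (n - 1)) = 0"
      unfolding f1 f2 by simp
    hence s3: "r' a $ (n - 1) = s * r a $ (n - 1)" using v(3) by simp
    have "r' a = s \<cdot>\<^sub>v r a"
    proof (rule eq_vecI)
      fix i assume "i < dim_vec (s \<cdot>\<^sub>v r a)"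
      hence i: "i < n" using c by simp
      consider "i = n - 1" | "i = a" | "i = a - 1" | "i < n - 1" "i \<noteq> a" "i \<noteq> a - 1" using i by linarith
      thus "r' a $ i = (s \<cdot>\<^sub>v r a) $ i" using s1 s2 s3 z i c by cases auto
    qed (use c in simp)
    thus ?thesis by blast
  qed
  then obtain s where s: "\<And>a. a \<in> B \<Longrightarrow> r' a = s a \<cdot>\<^sub>v r a" by metis
  show ?thesis
  proof
    fix x assume "x \<in> row_combs n B r'"
    then obtain c where c: "x = vec n (\<lambda>i. \<Sum>a\<in>B. c a * r' a $ i)" unfolding row_combs_def by auto
    have "x = vec n (\<lambda>i. \<Sum>a\<in>B. (c a * s a) * r a $ i)" unfolding c
      using s r by (intro eq_vecI) (auto simp: fan_rows_def intro!: sum.cong)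
    thus "x \<in> row_combs n B r" unfolding row_combs_def
      by (intro CollectI exI[of _ "\<lambda>a. c a * s a"]) simp
  qed
qed

section \<open>Trips in caterpillars\<close>

text \<open>Around \<open>Intl t\<close> the clockwise order is above, right, left. A trip that
  starts at the left end or above a white vertex only meets these three turns.\<close>

lemma turn_caterpillar:
  assumes "1 \<le> t" "t \<le> n - 2"
    and L: "L = (if t = 1 then Bdry 1 else Intl (t - 1))"
    and R: "R = (if t = n - 2 then Bdry n else Intl (t + 1))"
  shows "t \<in> B \<Longrightarrow> turn (caterpillar n B) t L = R"
    and "t \<notin> B \<Longrightarrow> turn (caterpillar n B) t L = Bdry (t + 1)"
    and "t \<notin> B \<Longrightarrow> turn (caterpillar n B) t (Bdry (t + 1)) = R"
  using assms by (auto simp: turn_def caterpillar_def transpose_def)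

text \<open>The trip runs along the path to the right until it meets a white vertex or the end.\<close>

lemma trip_perm_caterpillar:
  assumes n: "3 \<le> n" and j: "j < w" "w \<le> n - 1" and start: "j = 0 \<or> j \<notin> B"
    and black: "\<And>t. j < t \<Longrightarrow> t < w \<Longrightarrow> t \<in> B" and stop: "w = n - 1 \<or> w \<notin> B"
  shows "trip_perm (caterpillar n B) (j + 1) = w + 1"
proof -
  let ?G = "caterpillar n B"
  let ?L = "\<lambda>t. if t = 1 then Bdry 1 else Intl (t - 1)"
  let ?R = "\<lambda>t. if t = n - 2 then Bdry n else Intl (t + 1)"
  have first: "hd (nbrs ?G (Bdry (j + 1))) = Intl (if j = 0 then 1 else j)"
    using n j by (auto simp: caterpillar_def)
  have int: "intls ?G = {1..n - 2}" by (simp add: caterpillar_def)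
  note T = turn_caterpillar[OF _ _ refl refl, where n = n and B = B]
  \<comment> \<open>The three alternatives are the descent from the starting vertex, a step to the
    right that has not passed \<open>w\<close>, and the last edge. Uniqueness of the end, which
    \<open>THE\<close> requires, follows from this.\<close>
  have inv: "(0 < j \<and> u = Bdry (j + 1) \<and> v = Intl j) \<or> (\<exists>t. j < t \<and> t \<le> w \<and> t \<le> n - 2 \<and> u = ?L t \<and> v = Intl t)
      \<or> v = Bdry (w + 1)" if "trip ?G (j + 1) u v" for u v
    using that
  proof induction
    case start
    show ?case
    proof (cases "j = 0")
      case True
      hence "j < 1 \<and> 1 \<le> w \<and> 1 \<le> n - 2 \<and> Bdry (j + 1) = ?L 1 \<and> hd (nbrs ?G (Bdry (j + 1))) = Intl 1"
        using n j first by auto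
      thus ?thesis by blast
    next
      case False
      thus ?thesis using first by simp
    qed
  next
    case (step u v)
    have v: "1 \<le> v" "v \<le> n - 2" using step.hyps(2) int by auto
    have right: "(\<exists>t. j < t \<and> t \<le> w \<and> t \<le> n - 2 \<and> Intl v = ?L t \<and> ?R v = Intl t) \<or> ?R v = Bdry (w + 1)"
      if "j \<le> v" "v < w"
    proof (cases "v = n - 2")
      case True
      hence "w + 1 = n" using that j n by linarith
      thus ?thesis using True by auto
    next
      case False
      thus ?thesis using that v by (intro disjI1 exI[of _ "v + 1"]) auto
    qed
    from step.IH consider "0 < j" "u = Bdry (j + 1)" "v = j" | "j < v" "v \<le> w" "u = ?L v" by auto
    thus ?case
    proof cases
      case 1
      hence "turn ?G v u = ?R v" using T(3)[OF v] start by simp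
      thus ?thesis using right 1 j by auto
    next
      case 2
      show ?thesis
      proof (cases "v \<in> B")
        case True
        hence "turn ?G v u = ?R v" using T(1)[OF v] 2 by simp
        moreover have "v < w" using True stop 2 v n by (cases "v = w") auto
        ultimately show ?thesis using right 2 by auto
      next
        case False
        hence "turn ?G v u = Bdry (v + 1)" using T(2)[OF v] 2 by simp
        moreover have "v = w" using False black[of v] 2 by fastforce
        ultimately show ?thesis by simp
      qed
    qed
  qed
  have reach: "trip ?G (j + 1) (?L t) (Intl t)" if "j < t" "t \<le> w" "t \<le> n - 2" for t
    using that
  proof (induction t)
    case (Suc t)
    show ?case
    proof (cases "t = j")
      case True
      show ?thesis
      proof (cases "j = 0")
        case True
        thus ?thesis using trip.start[of ?G "j + 1"] first \<open>t = j\<close> by simp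
      next
        case False
        have "trip ?G (j + 1) (Bdry (j + 1)) (Intl j)"
          using trip.start[of ?G "j + 1"] first False by simp
        from trip.step[OF this] show ?thesis
          using T(3)[of j] False start \<open>t = j\<close> Suc.prems int by auto
      qed
    next
      case False
      from trip.step[OF Suc.IH] T(1)[of t] black[of t] False Suc.prems int
      show ?thesis by auto
    qed
  qed simp
  have "\<exists>u. trip ?G (j + 1) u (Bdry (w + 1))"
  proof (cases "w = n - 1")
    case False
    have "w \<le> n - 2" using False j by linarith
    have "trip ?G (j + 1) (?L w) (Intl w)" by (rule reach) (use j False in auto)
    from trip.step[OF this] T(2)[of w] False stop j int \<open>w \<le> n - 2\<close>
    have "trip ?G (j + 1) (Intl w) (Bdry (w + 1))" by auto
    thus ?thesis by blast
  next
    case w: True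
    show ?thesis
    proof (cases "j = n - 2")
      case True
      have "trip ?G (j + 1) (Bdry (j + 1)) (Intl j)"
        using trip.start[of ?G "j + 1"] first n True by simp
      from trip.step[OF this] T(3)[of j] have "trip ?G (j + 1) (Intl j) (Bdry n)"
        using True start w n int by auto
      thus ?thesis using w n by auto
    next
      case False
      have "trip ?G (j + 1) (?L (n - 2)) (Intl (n - 2))" by (rule reach) (use j False w in auto)
      moreover have "1 \<le> n - 2" "n - 2 \<in> B" using black[of "n - 2"] False w n j by auto
      ultimately have "trip ?G (j + 1) (Intl (n - 2)) (Bdry n)"
        using trip.step[of ?G "j + 1" "?L (n - 2)" "n - 2"] T(1)[of "n - 2"] int by auto
      thus ?thesis using w n by auto
    qed
  qed
  hence "(THE j'. \<exists>u. trip ?G (j + 1) u (Bdry j')) = w + 1"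
    using inv by (intro the_equality) (auto split: if_splits)
  moreover have "bsize ?G = n" by (simp add: caterpillar_def)
  ultimately show ?thesis using j n unfolding trip_perm_def by auto
qed

text \<open>The shift by one turns the end \<open>w + 1\<close> of a trip into \<open>w\<close>. As
  a column number counted from 1 this is the 0-based column \<open>w - 1\<close>, the last one
  before \<open>w\<close>.\<close>

lemma long_cycle_Suc:
  assumes "1 \<le> w" "w < n"
  shows "long_cycle n (w + 1) = w"
proof -
  let ?cs = "rev [1..<n + 1]"
  have "map (cycle_of_list ?cs) ?cs = rotate1 ?cs"
    using cyclic_rotation[of ?cs 1] by simp
  moreover have len: "length ?cs = n" by simp
  ultimately have "cycle_of_list ?cs (?cs ! i) = ?cs ! (Suc i mod n)" if "i < n" for i
    using that by (metis nth_map nth_rotate1 length_map)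
  \<comment> \<open>Position \<open>i\<close> of the reversed list holds
    \<open>n - i\<close>.\<close>
  from this[of "n - w - 1"] show ?thesis
    using assms unfolding long_cycle_def by (simp add: rev_nth del: upt_Suc)
qed

section \<open>Fan-shaped rows from dependencies between columns\<close>

text \<open>The apex \<open>n - 1\<close> is outside \<open>B\<close> and bounds the search.
  Together with the search to the left, every run of \<open>B\<close> is enclosed by two indices
  outside \<open>B\<close>.\<close>

lemma next_outside:
  fixes B :: "nat set"
  assumes "B \<subseteq> {1..<n - 1}" "t < n - 1"
  obtains w where "t < w" "w \<le> n - 1" "w \<notin> B" "{t<..<w} \<subseteq> B"
proof -
  have "n - 1 \<notin> B" using assms by auto
  define w where "w = (LEAST w. t < w \<and> w \<notin> B)"
  have "\<exists>w. t < w \<and> w \<notin> B" using assms(2) \<open>n - 1 \<notin> B\<close> by blast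
  hence "t < w \<and> w \<notin> B" unfolding w_def by (rule LeastI_ex)
  moreover have "w \<le> n - 1"
    unfolding w_def by (rule Least_le) (use assms \<open>n - 1 \<notin> B\<close> in auto)
  moreover have "x \<in> B" if "t < x" "x < w" for x
    using not_less_Least[of x "\<lambda>w. t < w \<and> w \<notin> B"] that unfolding w_def by simp
  hence "{t<..<w} \<subseteq> B" by (meson greaterThanLessThan_iff subsetI)
  ultimately show ?thesis using that[of w] by simp
qed

lemma previous_outside:
  fixes B :: "nat set"
  assumes "0 \<notin> B" "a \<in> B"
  obtains i where "i < a" "i \<notin> B" "{i<..a} \<subseteq> B"
proof -
  let ?S = "{i. i < a \<and> i \<notin> B}"
  define i where "i = Max ?S"
  have fin: "finite ?S" by simp
  have "a \<noteq> 0" using assms by metis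
  hence ne: "?S \<noteq> {}" using assms by blast
  have "i \<in> ?S" unfolding i_def by (rule Max_in[OF fin ne])
  moreover have "x \<in> B" if "i < x" "x \<le> a" for x
  proof (rule ccontr)
    assume "x \<notin> B"
    hence "x \<in> ?S" using that assms by (cases "x = a") auto
    hence "x \<le> i" unfolding i_def by (rule Max_ge[OF fin])
    thus False using that by simp
  qed
  hence "{i<..a} \<subseteq> B" by (meson greaterThanAtMost_iff subsetI)
  ultimately show ?thesis using that[of i] by simp
qed

lemma sorted_list_of_set_split:
  fixes J :: "nat set"
  assumes "finite J" "x \<in> J"
  shows "sorted_list_of_set J = sorted_list_of_set {t \<in> J. t < x} @ [x] @ sorted_list_of_set {t \<in> J. x < t}"
proof (rule sorted_distinct_set_unique)
  show "set (sorted_list_of_set J)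
      = set (sorted_list_of_set {t \<in> J. t < x} @ [x] @ sorted_list_of_set {t \<in> J. x < t})"
    using assms by auto
  show "sorted (sorted_list_of_set J)" "distinct (sorted_list_of_set J)" by simp_all
qed (simp_all add: assms sorted_append, fastforce+)

lemma sorted_list_of_set_split_notin:
  fixes J :: "nat set"
  assumes "finite J" "x \<notin> J"
  shows "sorted_list_of_set J = sorted_list_of_set {t \<in> J. t < x} @ sorted_list_of_set {t \<in> J. x < t}"
proof (rule sorted_distinct_set_unique)
  show "set (sorted_list_of_set J)
      = set (sorted_list_of_set {t \<in> J. t < x} @ sorted_list_of_set {t \<in> J. x < t})"
    using assms by (auto, metis linorder_neqE_nat)
  show "sorted (sorted_list_of_set J)" "distinct (sorted_list_of_set J)" by simp_all
qed (simp_all add: assms sorted_append, fastforce+)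

lemma sorted_list_of_set_insert_greatest:
  fixes J :: "nat set"
  assumes "finite J" "\<And>t. t \<in> J \<Longrightarrow> t < x"
  shows "sorted_list_of_set (insert x J) = sorted_list_of_set J @ [x]"
proof (rule sorted_distinct_set_unique)
  have "x \<notin> J" using assms(2) by blast
  thus "distinct (sorted_list_of_set J @ [x])" using assms(1) by simp
  show "sorted (sorted_list_of_set J @ [x])"
    using assms by (simp add: sorted_append less_imp_le)
  show "set (sorted_list_of_set (insert x J)) = set (sorted_list_of_set J @ [x])"
    using assms(1) by (subst set_sorted_list_of_set) auto
qed (rule sorted_sorted_list_of_set, rule distinct_sorted_list_of_set)

text \<open>\<open>V\<close> is a point of the nonnegative Grassmannian; \<open>P\<close> gives its Pluecker coordinates, indexed by
  lists of columns.\<close>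

locale nonneg_space =
  fixes n k :: nat and V :: "real vec set" and P :: "nat list \<Rightarrow> real"
  assumes V_carrier: "V \<subseteq> carrier_vec n"
    and V_nonempty: "V \<noteq> {}"
    and V_lincomb: "\<And>x y c d. x \<in> V \<Longrightarrow> y \<in> V \<Longrightarrow> c \<cdot>\<^sub>v x + d \<cdot>\<^sub>v y \<in> V"
    and slot: "\<And>xs ys. length xs + length ys + 1 = k \<Longrightarrow> \<exists>r \<in> V. \<forall>i < n. r $ i = P (xs @ [i] @ ys)"
    and P_not_distinct: "\<And>ps. length ps = k \<Longrightarrow> \<not> distinct ps \<Longrightarrow> P ps = 0"
    and P_move: "\<And>xs v ys. length xs + length ys + 1 = k \<Longrightarrow> P (xs @ [v] @ ys) = (-1) ^ length ys * P (xs @ ys @ [v])"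
    and P_nonneg: "\<And>ps. sorted ps \<Longrightarrow> distinct ps \<Longrightarrow> length ps = k \<Longrightarrow> set ps \<subseteq> {..<n} \<Longrightarrow> 0 \<le> P ps"
    and P_eq_0: "\<And>ps. length ps = k \<Longrightarrow> set ps \<subseteq> {..<n} \<Longrightarrow> P ps = 0 \<Longrightarrow>
      \<exists>r \<in> V. (\<forall>t \<in> set ps. r $ t = 0) \<and> (\<exists>i < n. r $ i \<noteq> 0)"

text \<open>A linear dependency of column \<open>i\<close> on columns \<open>S\<close> is expressed by: a row in \<open>V\<close> vanishing on \<open>S\<close>
  vanishes at \<open>i\<close>.\<close>

locale fan_dependencies = nonneg_space +
  fixes B :: "nat set"
  assumes B: "B \<subseteq> {1..<n - 1}" and card_B: "card B = k"
    and run_start: "\<And>i w r. \<lbrakk>i < w; w \<le> n - 1; i \<notin> B; w \<notin> B; {i<..<w} \<subseteq> B; r \<in> V;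
      \<forall>t \<in> {i<..<w}. r $ t = 0\<rbrakk> \<Longrightarrow> r $ i = 0"
    and run_end: "\<And>i w r. \<lbrakk>i + 1 < w; w \<le> n - 1; i \<notin> B; w \<notin> B; {i<..<w} \<subseteq> B; r \<in> V;
      \<forall>t \<in> {i..<w - 1}. r $ t = 0\<rbrakk> \<Longrightarrow> r $ (w - 1) = 0"
    and no_coloop: "\<And>i r. \<lbrakk>i < n; r \<in> V; \<forall>t < n. t \<noteq> i \<longrightarrow> r $ t = 0\<rbrakk> \<Longrightarrow> r $ i = 0"
begin

lemma finite_B: "finite B" using B finite_subset by auto

text \<open>The columns after an index \<open>t\<close> outside \<open>B\<close>, up to the next
  index outside \<open>B\<close>, all lie in \<open>B\<close>, so \<open>run_start\<close> gives the
  entry at \<open>t\<close>. Only the apex remains, and it is not a coloop. In matroid terms,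
  \<open>B\<close> is spanning.\<close>

lemma zero_if_zero_on_B:
  assumes r: "r \<in> V" "\<forall>t \<in> B. r $ t = 0" and t: "t < n"
  shows "r $ t = 0"
proof -
  have *: "r $ t = 0" if t: "t < n - 1" for t
  proof (cases "t \<in> B")
    case False
    obtain w where "t < w" "w \<le> n - 1" "w \<notin> B" "{t<..<w} \<subseteq> B"
      using next_outside[OF B t] .
    thus ?thesis using run_start[of t w r] r False by blast
  qed (use r in simp)
  show ?thesis
  proof (cases "t = n - 1")
    case True
    show ?thesis by (rule no_coloop) (use t r True * in auto)
  qed (use * t in simp)
qed

section \<open>Pluecker coordinates along one run of the black set\<close>

context
  fixes i w :: nat
  assumes iw: "i < w" "w \<le> n - 1" "i \<notin> B" "w \<notin> B" and run: "{i<..<w} \<subseteq> B"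
begin

text \<open>The left end \<open>i\<close> is exchanged for \<open>b\<close>; in particular
  \<open>J i = B\<close>.\<close>

abbreviation J :: "nat \<Rightarrow> nat set" where
  "J b \<equiv> insert i B - {b}"

lemma J_finite: "finite (J b)" using finite_B by simp

lemma J_less: "t \<in> J b \<Longrightarrow> t < n - 1" using B iw by auto

lemma card_J:
  assumes "i \<le> b" "b < w"
  shows "card (J b) = k"
proof -
  have "b \<in> insert i B" using assms run by (cases "b = i") auto
  thus ?thesis using finite_B iw card_B by simp
qed

text \<open>A run that begins at an index outside \<open>insert i B\<close> cannot meet
  \<open>{i..<w}\<close>, since it would have to contain \<open>i\<close>. So it avoids
  \<open>a - 1\<close> and \<open>a\<close>, and \<open>run_start\<close> applies.\<close>

lemma zero_outside:
  assumes a: "i < a" "a < w" and r: "r \<in> V" "\<forall>t \<in> insert i B - {a - 1, a}. r $ t = 0"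
    and t: "t < n - 1" "t \<noteq> a - 1" "t \<noteq> a"
  shows "r $ t = 0"
proof (cases "t \<in> insert i B")
  case False
  obtain w' where w': "t < w'" "w' \<le> n - 1" "w' \<notin> B" "{t<..<w'} \<subseteq> B"
    using next_outside[OF B t(1)] .
  have "b \<notin> {t<..<w'}" if "i \<le> b" "b < w" for b
  proof
    assume b: "b \<in> {t<..<w'}"
    have "t < w" using b that by simp
    hence "\<not> i < t" using False run by auto
    hence "i \<in> {t<..<w'}" using False b that by auto
    thus False using w' iw by auto
  qed
  hence "a - 1 \<notin> {t<..<w'}" "a \<notin> {t<..<w'}" using a by auto
  hence "\<forall>s \<in> {t<..<w'}. r $ s = 0" using w' r by auto
  thus ?thesis using run_start[of t w' r] w' r False by blast
qed (use r t in simp)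

text \<open>The row of Pluecker coordinates with one free slot where \<open>a - 1\<close> and
  \<open>a\<close> are left out. Either of the two keeps the list sorted, an index already present
  gives zero, and the apex has to move past the elements above \<open>a\<close>, whence the sign.
  This becomes the fan row of \<open>a\<close>.\<close>

lemma exchange_row:
  assumes a: "i < a" "a < w"
  obtains f where "f \<in> V" "f $ (a - 1) = P (sorted_list_of_set (J a))"
    "f $ a = P (sorted_list_of_set (J (a - 1)))"
    "\<And>t. t \<in> insert i B - {a - 1, a} \<Longrightarrow> f $ t = 0"
    "f $ (n - 1) = (-1) ^ card {t \<in> B. a < t}
      * P (sorted_list_of_set (insert (n - 1) (insert i B - {a - 1, a})))"
proof -
  let ?J = "insert i B - {a - 1, a}"
  let ?xs = "sorted_list_of_set {t \<in> ?J. t < a}" and ?ys = "sorted_list_of_set {t \<in> ?J. a < t}"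
  have "a \<in> {i<..<w}" "a - 1 = i \<or> a - 1 \<in> {i<..<w}" using a by auto
  hence a': "a \<in> B" "a - 1 \<in> insert i B" using run by blast+
  have a'': "a - 1 < a" using a by simp
  have fin: "finite ?J" using finite_B by simp
  have La: "sorted_list_of_set (J a) = ?xs @ [a - 1] @ ?ys"
  proof -
    have eq: "{t \<in> J a. t < a - 1} = {t \<in> ?J. t < a}" "{t \<in> J a. a - 1 < t} = {t \<in> ?J. a < t}"
      using a'' by auto
    have "a - 1 \<in> J a" using a' a'' by simp
    from sorted_list_of_set_split[OF J_finite this] show ?thesis unfolding eq .
  qed
  have La1: "sorted_list_of_set (J (a - 1)) = ?xs @ [a] @ ?ys"
  proof -
    have eq: "{t \<in> J (a - 1). t < a} = {t \<in> ?J. t < a}" "{t \<in> J (a - 1). a < t} = {t \<in> ?J. a < t}"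
      using a'' by auto
    have "a \<in> J (a - 1)" using a' a'' by simp
    from sorted_list_of_set_split[OF J_finite this] show ?thesis unfolding eq .
  qed
  have "{t \<in> ?J. t < a} \<union> {t \<in> ?J. a < t} = ?J" by auto
  hence setxy: "set (?xs @ ?ys) = ?J" using fin by auto
  have len: "length ?xs + length ?ys + 1 = k"
  proof -
    have "length (?xs @ [a - 1] @ ?ys) = k" unfolding La[symmetric] using card_J[of a] a by simp
    thus ?thesis by simp
  qed
  obtain f where f: "f \<in> V" "\<And>t. t < n \<Longrightarrow> f $ t = P (?xs @ [t] @ ?ys)"
    using slot[OF len] by blast
  have n: "n - 1 < n" "a < n" "a - 1 < n" using a iw by auto
  have apex: "f $ (n - 1) = (-1) ^ length ?ys * P (?xs @ ?ys @ [n - 1])"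
    using f(2)[OF n(1)] P_move[OF len] by simp
  have len_ys: "length ?ys = card {t \<in> B. a < t}"
  proof -
    have "{t \<in> ?J. a < t} = {t \<in> B. a < t}" using a by auto
    thus ?thesis by simp
  qed
  have sorted_apex: "?xs @ ?ys @ [n - 1] = sorted_list_of_set (insert (n - 1) ?J)"
  proof -
    have "sorted_list_of_set (insert (n - 1) ?J) = sorted_list_of_set ?J @ [n - 1]"
      by (rule sorted_list_of_set_insert_greatest[OF fin]) (use J_less[of _ a] in auto)
    moreover have "sorted_list_of_set ?J = ?xs @ ?ys"
      by (rule sorted_list_of_set_split_notin[OF fin]) simp
    ultimately show ?thesis by simp
  qed
  have zero: "f $ t = 0" if "t \<in> ?J" for t
  proof -
    have "t < n" using J_less[of t a] that by fastforce
    moreover have "\<not> distinct (?xs @ [t] @ ?ys)" using setxy that by auto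
    ultimately show ?thesis using f(2) P_not_distinct[of "?xs @ [t] @ ?ys"] len by simp
  qed
  show ?thesis
  proof (rule that[of f])
    show "f $ (a - 1) = P (sorted_list_of_set (J a))" unfolding La by (rule f(2)[OF n(3)])
    show "f $ a = P (sorted_list_of_set (J (a - 1)))" unfolding La1 by (rule f(2)[OF n(2)])
  qed (use f(1) zero apex in \<open>simp_all only: len_ys sorted_apex\<close>)
qed

text \<open>Here the slot is that of \<open>a - 1\<close> in \<open>B\<close>. The apex also has to
  move past \<open>a\<close>, so its sign is opposite to that in
  \<open>exchange_row\<close>.\<close>

lemma basis_row:
  assumes a: "i < a" "a < w" "a - 1 \<in> B"
  obtains g where "g \<in> V" "g $ (a - 1) = P (sorted_list_of_set B)"
    "\<And>t. t \<in> B - {a - 1} \<Longrightarrow> g $ t = 0"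
    "g $ (n - 1) = - ((-1) ^ card {t \<in> B. a < t})
      * P (sorted_list_of_set (insert (n - 1) (B - {a - 1})))"
proof -
  let ?J = "B - {a - 1}"
  let ?xs = "sorted_list_of_set {t \<in> B. t < a - 1}" and ?ys = "sorted_list_of_set {t \<in> B. a - 1 < t}"
  have a': "a \<in> B" "a - 1 < a" using a run by auto
  have fin: "finite ?J" using finite_B by simp
  have La: "sorted_list_of_set B = ?xs @ [a - 1] @ ?ys"
    using sorted_list_of_set_split[OF finite_B a(3)] .
  have "{t \<in> B. t < a - 1} \<union> {t \<in> B. a - 1 < t} = ?J" by auto
  hence setxy: "set (?xs @ ?ys) = ?J" using finite_B by auto
  have "length (?xs @ [a - 1] @ ?ys) = k" unfolding La[symmetric] using card_B by simp
  hence len: "length ?xs + length ?ys + 1 = k" by simp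
  obtain g where g: "g \<in> V" "\<And>t. t < n \<Longrightarrow> g $ t = P (?xs @ [t] @ ?ys)"
    using slot[OF len] by blast
  have n: "n - 1 < n" "a - 1 < n" using a iw by auto
  have apex: "g $ (n - 1) = (-1) ^ length ?ys * P (?xs @ ?ys @ [n - 1])"
    using g(2)[OF n(1)] P_move[OF len] by simp
  have len_ys: "length ?ys = Suc (card {t \<in> B. a < t})"
  proof -
    have "{t \<in> B. a - 1 < t} = insert a {t \<in> B. a < t}" using a a' by auto
    thus ?thesis using finite_B by simp
  qed
  have sorted_apex: "?xs @ ?ys @ [n - 1] = sorted_list_of_set (insert (n - 1) ?J)"
  proof -
    have eq: "{t \<in> ?J. t < a - 1} = {t \<in> B. t < a - 1}" "{t \<in> ?J. a - 1 < t} = {t \<in> B. a - 1 < t}" by auto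
    have "sorted_list_of_set (insert (n - 1) ?J) = sorted_list_of_set ?J @ [n - 1]"
      by (rule sorted_list_of_set_insert_greatest[OF fin]) (use B in auto)
    moreover have "sorted_list_of_set ?J = ?xs @ ?ys"
      using sorted_list_of_set_split_notin[OF fin, of "a - 1"] unfolding eq by simp
    ultimately show ?thesis by simp
  qed
  have zero: "g $ t = 0" if "t \<in> ?J" for t
  proof -
    have "t < n" using that subsetD[OF B, of t] by auto
    moreover have "\<not> distinct (?xs @ [t] @ ?ys)" using setxy that by auto
    ultimately show ?thesis using g(2) P_not_distinct[of "?xs @ [t] @ ?ys"] len by simp
  qed
  show ?thesis
  proof (rule that[of g])
    show "g $ (a - 1) = P (sorted_list_of_set B)" unfolding La by (rule g(2)[OF n(2)])
    show "g $ (n - 1) = - ((-1) ^ card {t \<in> B. a < t}) * P (sorted_list_of_set (insert (n - 1) ?J))"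
      using apex unfolding len_ys sorted_apex by simp
  qed (use g(1) zero in simp_all)
qed

lemma P_set_nonneg:
  assumes "S \<subseteq> {..<n}" "card S = k"
  shows "0 \<le> P (sorted_list_of_set S)"
proof (rule P_nonneg)
  have "finite S" using assms(1) finite_subset by blast
  thus "set (sorted_list_of_set S) \<subseteq> {..<n}" using assms(1) by simp
  show "length (sorted_list_of_set S) = k" using assms(2) by simp
qed simp_all

lemma P_insert_nonneg:
  assumes "S \<subseteq> {..<n - 1}" "card S = k - 1" "0 < k"
  shows "0 \<le> P (sorted_list_of_set (insert (n - 1) S))"
proof (rule P_set_nonneg)
  have "finite S" "n - 1 \<notin> S" using assms(1) finite_subset by auto
  thus "card (insert (n - 1) S) = k" using assms by simp
qed (use assms iw in auto)

lemma P_J_nonneg: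
  assumes "i \<le> b" "b < w"
  shows "0 \<le> P (sorted_list_of_set (J b))"
proof (rule P_set_nonneg[OF _ card_J[OF assms]])
  show "J b \<subseteq> {..<n}"
  proof
    fix t assume "t \<in> J b"
    from J_less[OF this] show "t \<in> {..<n}" by simp
  qed
qed

lemma P_B_pos: "0 < P (sorted_list_of_set B)"
proof -
  have "P (sorted_list_of_set B) \<noteq> 0"
    using P_eq_0[of "sorted_list_of_set B"] zero_if_zero_on_B B card_B finite_B by fastforce
  moreover have "0 \<le> P (sorted_list_of_set B)"
    using P_J_nonneg[of i] iw by simp
  ultimately show ?thesis by simp
qed

text \<open>Downward induction: if \<open>P\<close> vanished at \<open>J (a - 1)\<close> but not at \<open>J a\<close>, the rows \<open>f\<close> of \<open>exchange_row\<close>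
  and \<open>g\<close> of \<open>basis_row\<close> would be proportional, although their apex entries have opposite signs; hence
  these vanish and column \<open>a - 1\<close> would be a coloop.\<close>

lemma P_J_pos:
  assumes "i < b" "b < w"
  shows "0 < P (sorted_list_of_set (J b))"
  using assms
proof (induction "w - b" arbitrary: b)
  case (Suc m)
  have "P (sorted_list_of_set (J b)) \<noteq> 0"
  proof
    assume 0: "P (sorted_list_of_set (J b)) = 0"
    show False
    proof (cases "b = w - 1")
      case True
      have "length (sorted_list_of_set (J b)) = k" using card_J Suc.prems by simp
      moreover have "set (sorted_list_of_set (J b)) \<subseteq> {..<n}"
        using J_less[of _ b] J_finite[of b] by fastforce
      ultimately obtain r where r: "r \<in> V" "\<forall>t \<in> J b. r $ t = 0" "\<exists>t < n. r $ t \<noteq> 0"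
        using P_eq_0[OF _ _ 0] J_finite by auto
      have "t \<in> J b" if "t \<in> {i..<w - 1}" for t
        using that run True by (cases "t = i") auto
      \<comment> \<open>The right end \<open>b\<close> of the run is the only element of
        \<open>B\<close> missing from \<open>J b\<close>; \<open>run_end\<close> supplies
        it.\<close>
      hence "r $ b = 0" unfolding True
        using Suc.prems iw run r True by (intro run_end[of i w r]) auto
      hence "\<forall>t \<in> B. r $ t = 0" using r by auto
      thus False using zero_if_zero_on_B r by blast
    next
      case False
      define a where "a = b + 1"
      have a: "i < a" "a < w" "a - 1 = b" "b \<in> B" "a \<in> B" "b \<noteq> i"
        using Suc.prems False run unfolding a_def by auto
      have Ja: "0 < P (sorted_list_of_set (J a))"
        by (rule Suc.hyps(1)) (use Suc.hyps(2) a in \<open>auto simp: a_def\<close>)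
      obtain f where f: "f \<in> V" "f $ b = P (sorted_list_of_set (J a))"
          "f $ a = P (sorted_list_of_set (J b))" "\<And>t. t \<in> insert i B - {b, a} \<Longrightarrow> f $ t = 0"
          "f $ (n - 1) = (-1) ^ card {t \<in> B. a < t}
            * P (sorted_list_of_set (insert (n - 1) (insert i B - {b, a})))"
        using exchange_row[OF a(1,2)] unfolding a(3) by blast
      obtain g where g: "g \<in> V" "g $ b = P (sorted_list_of_set B)"
          "\<And>t. t \<in> B - {b} \<Longrightarrow> g $ t = 0"
          "g $ (n - 1) = - ((-1) ^ card {t \<in> B. a < t})
            * P (sorted_list_of_set (insert (n - 1) (B - {b})))"
        using basis_row[OF a(1,2)] a(4) unfolding a(3) by blast
      let ?p = "P (sorted_list_of_set (insert (n - 1) (insert i B - {b, a})))"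
      let ?q = "P (sorted_list_of_set (insert (n - 1) (B - {b})))"
      have k: "0 < k" using a(4) finite_B card_B by (metis card_gt_0_iff empty_iff)
      have p: "0 \<le> ?p"
      proof (rule P_insert_nonneg)
        show "insert i B - {b, a} \<subseteq> {..<n - 1}" using B iw by auto
        show "card (insert i B - {b, a}) = k - 1"
          using a finite_B card_B iw by (simp add: card_Diff_subset)
      qed (use k in simp)
      have q: "0 \<le> ?q"
      proof (rule P_insert_nonneg)
        show "B - {b} \<subseteq> {..<n - 1}" using B by auto
        show "card (B - {b}) = k - 1" using a finite_B card_B by simp
      qed (use k in simp)
      \<comment> \<open>The entries at \<open>b\<close> cancel, and elsewhere on \<open>B\<close>
        both rows vanish, at \<open>a\<close> by the assumption \<open>0\<close>. Hence
        \<open>h\<close> vanishes at the apex too.\<close>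
      define h where "h = g $ b \<cdot>\<^sub>v f + (- f $ b) \<cdot>\<^sub>v g"
      have dim: "dim_vec f = n" "dim_vec g = n" using f g V_carrier by auto
      have hV: "h \<in> V" unfolding h_def using f g by (intro V_lincomb)
      have h: "h $ t = g $ b * f $ t - f $ b * g $ t" if "t < n" for t
        unfolding h_def using dim that by simp
      have "h $ t = 0" if "t \<in> B" for t
      proof -
        have "t < n" using subsetD[OF B that] by auto
        moreover have "f $ t = 0" if "t \<noteq> b" using f(3,4) 0 \<open>t \<in> B\<close> that by (cases "t = a") auto
        ultimately show ?thesis using h[of t] g(3)[of t] that by (cases "t = b") auto
      qed
      hence "h $ (n - 1) = 0" using zero_if_zero_on_B[OF hV] iw by auto
      hence "(-1) ^ card {t \<in> B. a < t} * (g $ b * ?p + f $ b * ?q) = 0"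
        using h[of "n - 1"] f(5) g(4) iw by (simp add: algebra_simps)
      hence "g $ b * ?p + f $ b * ?q = 0" by simp
      moreover have "0 < g $ b" "0 < f $ b" using f(2) g(2) P_B_pos Ja by auto
      ultimately have "?p = 0" using p q
        by (metis add_nonneg_eq_0_iff mult_eq_0_iff mult_nonneg_nonneg less_imp_le less_numeral_extra(3))
      hence fn: "f $ (n - 1) = 0" using f(5) by simp
      have "f $ b = 0"
      proof (rule no_coloop)
        show "\<forall>t < n. t \<noteq> b \<longrightarrow> f $ t = 0"
        proof (intro allI impI)
          fix t assume t: "t < n" "t \<noteq> b"
          consider "t = n - 1" | "t = a" | "t < n - 1" "t \<noteq> a" using t by linarith
          thus "f $ t = 0"
            using fn f 0 zero_outside[OF a(1,2) f(1)] t unfolding a(3) by cases auto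
        qed
      qed (use f a iw in auto)
      thus False using f(2) Ja by simp
    qed
  qed
  thus ?case using P_J_nonneg[of b] Suc.prems by simp
qed simp

end

text \<open>Apply \<open>exchange_row\<close> to the run that contains \<open>a\<close>. If
  \<open>a - 1\<close> is its left end, the entry at \<open>a\<close> is the coordinate of
  \<open>B\<close> itself.\<close>

lemma ex_fan_row:
  assumes "a \<in> B"
  shows "\<exists>r \<in> V. 0 < r $ (a - 1) \<and> 0 < r $ a \<and> (\<forall>i < n - 1. i \<noteq> a - 1 \<longrightarrow> i \<noteq> a \<longrightarrow> r $ i = 0)"
proof -
  have "0 \<notin> B" "a < n - 1" using B assms by auto
  obtain i where i: "i < a" "i \<notin> B" "{i<..a} \<subseteq> B"
    using previous_outside[OF \<open>0 \<notin> B\<close> assms] .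
  obtain w where w: "a < w" "w \<le> n - 1" "w \<notin> B" "{a<..<w} \<subseteq> B"
    using next_outside[OF B \<open>a < n - 1\<close>] .
  have "{i<..<w} = {i<..a} \<union> {a<..<w}" using i w by auto
  hence iw: "i < w" "w \<le> n - 1" "i \<notin> B" "w \<notin> B" "{i<..<w} \<subseteq> B" using i w by auto
  obtain f where f: "f \<in> V" "f $ (a - 1) = P (sorted_list_of_set (insert i B - {a}))"
    "f $ a = P (sorted_list_of_set (insert i B - {a - 1}))"
    "\<And>t. t \<in> insert i B - {a - 1, a} \<Longrightarrow> f $ t = 0"
    using exchange_row[OF iw i(1) w(1)] by blast
  have "0 < f $ (a - 1)" using f(2) P_J_pos[OF iw i(1) w(1)] by simp
  moreover have "0 < f $ a"
  proof (cases "a - 1 = i")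
    case True
    thus ?thesis using f(3) P_B_pos[OF iw] i by simp
  next
    case False
    hence "i < a - 1" "a - 1 < w" using i w by auto
    thus ?thesis using f(3) P_J_pos[OF iw] by simp
  qed
  ultimately show ?thesis using f zero_outside[OF iw i(1) w(1) f(1)] by blast
qed

lemma row_combs_add:
  assumes x: "x \<in> row_combs n B r" and a: "a \<in> B" "r a \<in> carrier_vec n"
  shows "x + s \<cdot>\<^sub>v r a \<in> row_combs n B r"
proof -
  obtain c where c: "x = vec n (\<lambda>i. \<Sum>b\<in>B. c b * r b $ i)" using x unfolding row_combs_def by auto
  have "(\<Sum>b\<in>B. (c b + (if b = a then s else 0)) * r b $ i) = (\<Sum>b\<in>B. c b * r b $ i) + s * r a $ i" for i
  proof -
    have "(\<Sum>b\<in>B. (c b + (if b = a then s else 0)) * r b $ i)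
      = (\<Sum>b\<in>B. c b * r b $ i + (if b = a then s * r b $ i else 0))"
      by (rule sum.cong) (auto simp: algebra_simps)
    thus ?thesis using finite_B a by (simp add: sum.distrib)
  qed
  hence "x + s \<cdot>\<^sub>v r a = vec n (\<lambda>i. \<Sum>b\<in>B. (c b + (if b = a then s else 0)) * r b $ i)"
    unfolding c using a by (intro eq_vecI) auto
  thus ?thesis unfolding row_combs_def by (intro CollectI exI conjI TrueI)
qed

text \<open>Elimination from the largest element of \<open>B\<close> downwards: \<open>r m\<close>
  vanishes at all larger elements of \<open>B\<close>, so clearing the entry at \<open>m\<close>
  leaves the entries already cleared untouched. A row cleared on all of \<open>B\<close> is
  zero.\<close>

lemma ex_fan_rows: "\<exists>r. fan_rows n B r \<and> V = row_combs n B r"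
proof -
  obtain r where r: "\<And>a. a \<in> B \<Longrightarrow> r a \<in> V \<and> 0 < r a $ (a - 1) \<and> 0 < r a $ a
      \<and> (\<forall>i < n - 1. i \<noteq> a - 1 \<longrightarrow> i \<noteq> a \<longrightarrow> r a $ i = 0)"
    using ex_fan_row by metis
  have rc: "r a \<in> carrier_vec n" if "a \<in> B" for a using r that V_carrier by auto
  have fan: "fan_rows n B r" unfolding fan_rows_def using B r rc by auto
  have "x \<in> row_combs n B r" if "x \<in> V" "\<forall>b \<in> B. m \<le> b \<longrightarrow> x $ b = 0" for m x
    using that
  proof (induction m arbitrary: x)
    case 0
    have "x = vec n (\<lambda>i. \<Sum>a\<in>B. 0 * r a $ i)"
      using zero_if_zero_on_B[of x] 0 V_carrier by (intro eq_vecI) auto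
    thus ?case unfolding row_combs_def by (intro CollectI exI conjI TrueI)
  next
    case (Suc m)
    show ?case
    proof (cases "m \<in> B")
      case True
      define s where "s = x $ m / r m $ m"
      have dim: "dim_vec x = n" "dim_vec (r m) = n" using Suc.prems V_carrier rc[OF True] by auto
      let ?y = "1 \<cdot>\<^sub>v x + (- s) \<cdot>\<^sub>v r m"
      have y: "?y $ t = x $ t - s * r m $ t" if "t < n" for t using dim that by simp
      have "?y \<in> row_combs n B r"
      proof (rule Suc.IH)
        show "?y \<in> V" using Suc.prems r True by (intro V_lincomb) auto
        show "\<forall>b \<in> B. m \<le> b \<longrightarrow> ?y $ b = 0"
        proof (intro ballI impI)
          fix b assume b: "b \<in> B" "m \<le> b"
          hence bn: "b < n - 1" using B by auto
          show "?y $ b = 0"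
          proof (cases "b = m")
            case True
            thus ?thesis using y[of b] bn r[OF \<open>m \<in> B\<close>] by (simp add: s_def)
          next
            case False
            hence "r m $ b = 0" "x $ b = 0" using r[OF True] bn b Suc.prems by auto
            thus ?thesis using y[of b] bn by simp
          qed
        qed
      qed
      from row_combs_add[OF this True rc[OF True]]
      have "?y + s \<cdot>\<^sub>v r m \<in> row_combs n B r" .
      moreover have "?y + s \<cdot>\<^sub>v r m = x" using dim by (intro eq_vecI) auto
      ultimately show ?thesis by simp
    next
      case False
      show ?thesis by (rule Suc.IH) (use Suc.prems False in \<open>auto simp: Suc_le_eq le_less\<close>)
    qed
  qed
  moreover have "\<not> n \<le> b" if "b \<in> B" for b using subsetD[OF B that] by auto
  ultimately have "V \<subseteq> row_combs n B r" by blast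
  moreover have "vec n (\<lambda>i. \<Sum>a\<in>S. c a * r a $ i) \<in> V" if "S \<subseteq> B" for c S
    using finite_subset[OF that finite_B] that
  proof (induction S)
    case empty
    obtain x where x: "x \<in> V" using V_nonempty by auto
    have "0 \<cdot>\<^sub>v x + 0 \<cdot>\<^sub>v x = vec n (\<lambda>i. \<Sum>a\<in>{}. c a * r a $ i)" using V_carrier x by (intro eq_vecI) auto
    thus ?case using V_lincomb[OF x x, of 0 0] by simp
  next
    case (insert a S)
    have "1 \<cdot>\<^sub>v vec n (\<lambda>i. \<Sum>a\<in>S. c a * r a $ i) + c a \<cdot>\<^sub>v r a \<in> V"
      using insert r by (intro V_lincomb) auto
    moreover have "1 \<cdot>\<^sub>v vec n (\<lambda>i. \<Sum>a\<in>S. c a * r a $ i) + c a \<cdot>\<^sub>v r a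
        = vec n (\<lambda>i. \<Sum>a\<in>insert a S. c a * r a $ i)"
      using insert rc[of a] by (intro eq_vecI) auto
    ultimately show ?case by simp
  qed
  hence "row_combs n B r \<subseteq> V" unfolding row_combs_def by auto
  ultimately show ?thesis using fan by auto
qed

end

section \<open>Decorated permutations\<close>

lemma col_carrier: "A \<in> carrier_mat k n \<Longrightarrow> col A i \<in> carrier_vec k"
  by (rule carrier_vecI) simp

lemma transpose_mult_vec_index:
  fixes A :: "real mat"
  assumes "A \<in> carrier_mat k n" "y \<in> carrier_vec k" "i < n"
  shows "(A\<^sup>T *\<^sub>v y) $ i = y \<bullet> col A i"
proof -
  have "(A\<^sup>T *\<^sub>v y) $ i = col A i \<bullet> y" using assms by simp
  also have "\<dots> = y \<bullet> col A i" by (rule comm_scalar_prod[OF col_carrier[OF assms(1)] assms(2)])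
  finally show ?thesis .
qed

lemma represents_eq:
  assumes "represents k n A V"
  shows "V = {A\<^sup>T *\<^sub>v y | y. y \<in> carrier_vec k}" and "A \<in> carrier_mat k n"
proof -
  interpret vec_space "TYPE(real)" n .
  show A: "A \<in> carrier_mat k n" using assms unfolding represents_def by simp
  show "V = {A\<^sup>T *\<^sub>v y | y. y \<in> carrier_vec k}"
    using assms row_space_eq[OF A] A unfolding represents_def by auto
qed

text \<open>Dimension \<open>k\<close> means that the transpose has full column rank. Linear
  independence is a property of the set of columns, so their distinctness has to be derived before a
  kernel vector counts as a dependency.\<close>

lemma Gr_represents_inj:
  assumes V: "V \<in> Gr k n" and rep: "represents k n A V" and y: "y \<in> carrier_vec k" "A\<^sup>T *\<^sub>v y = 0\<^sub>v n"
  shows "y = 0\<^sub>v k"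
proof (rule ccontr)
  assume ne: "y \<noteq> 0\<^sub>v k"
  interpret vec_space "TYPE(real)" n .
  have AT: "A\<^sup>T \<in> carrier_mat n k" using rep unfolding represents_def by simp
  have rank: "rank A\<^sup>T = k"
    using V rep unfolding Gr_def represents_def rank_def row_space_eq_col_space_transpose col_space_def
    by simp
  obtain S where S: "maximal S (\<lambda>T. T \<subseteq> set (cols A\<^sup>T) \<and> lin_indpt T)"
    using maximal_exists[of "\<lambda>T. T \<subseteq> set (cols A\<^sup>T) \<and> lin_indpt T" "card (set (cols A\<^sup>T))" "{}"]
    by (meson List.finite_set card_mono empty_iff empty_subsetI finite_lin_indpt2 rev_finite_subset)
  hence "S \<subseteq> set (cols A\<^sup>T)" unfolding maximal_def by blast
  hence "card S \<le> card (set (cols A\<^sup>T))" by (rule card_mono[OF List.finite_set])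
  moreover have "card S = k" using rank_card_indpt[OF AT S] rank by (rule trans[OF sym])
  moreover have "length (cols A\<^sup>T) = k" using AT by simp
  ultimately have "card (set (cols A\<^sup>T)) = length (cols A\<^sup>T)"
    using card_length[of "cols A\<^sup>T"] by (intro le_antisym) simp_all
  hence dist: "distinct (cols A\<^sup>T)" by (rule card_distinct)
  from lin_depI[OF AT y(1) ne y(2) dist] full_rank_lin_indpt[OF AT rank dist]
  show False by contradiction
qed

lemma span_annihilator:
  fixes S :: "real vec set"
  assumes "S \<subseteq> carrier_vec k" "y \<in> carrier_vec k"
    and "v \<in> LinearCombinations.module.span class_ring (module_vec TYPE(real) k) S"
    and "\<And>s. s \<in> S \<Longrightarrow> y \<bullet> s = 0"
  shows "y \<bullet> v = 0"
proof -
  interpret vec_space "TYPE(real)" k .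
  have "y \<in> orthogonal_complement S" using assms unfolding orthogonal_complement_def by auto
  hence "y \<in> orthogonal_complement (span S)" using assms(1) by simp
  thus ?thesis using assms(3) unfolding orthogonal_complement_def by auto
qed

text \<open>The exchange property in dual form: in a combination giving \<open>v\<close> the
  coefficient of \<open>u\<close> is nonzero, hence a functional that kills \<open>v\<close> and
  \<open>S\<close> kills \<open>u\<close>.\<close>

lemma span_exchange_annihilator:
  fixes S :: "real vec set"
  assumes S: "S \<subseteq> carrier_vec k" and u: "u \<in> carrier_vec k" and y: "y \<in> carrier_vec k"
    and v: "v \<in> LinearCombinations.module.span class_ring (module_vec TYPE(real) k) (insert u S)"
    and nv: "v \<notin> LinearCombinations.module.span class_ring (module_vec TYPE(real) k) S"
    and y0: "\<And>s. s \<in> S \<Longrightarrow> y \<bullet> s = 0" "y \<bullet> v = 0"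
  shows "y \<bullet> u = 0"
proof -
  interpret vec_space "TYPE(real)" k .
  obtain a T where T: "v = lincomb a T" "finite T" "T \<subseteq> insert u S"
    using v in_spanE by metis
  have "u \<in> T" using nv T in_spanI[of v a T S] by auto
  define T' where "T' = T - {u}"
  have T': "T' \<subseteq> S" "finite T'" "u \<notin> T'" "T = insert u T'" using T \<open>u \<in> T\<close> unfolding T'_def by auto
  have c: "lincomb a T' \<in> carrier_vec k" using T' S by (intro lincomb_closed) auto
  have v_eq: "v = a u \<cdot>\<^sub>v u + lincomb a T'"
    unfolding T(1) T'(4) using T' S u by (subst lincomb_insert2) auto
  have sp: "lincomb a T' \<in> span S" using T' by (intro in_spanI) auto
  have "a u \<noteq> 0"
  proof
    assume "a u = 0"
    hence "v = lincomb a T'" unfolding v_eq using u c by auto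
    thus False using sp nv by simp
  qed
  moreover have "y \<bullet> lincomb a T' = 0" by (rule span_annihilator[OF S y sp y0(1)])
  hence "a u * (y \<bullet> u) = 0" using y0(2) y u c unfolding v_eq by (simp add: scalar_prod_add_distrib[of _ k])
  ultimately show ?thesis by simp
qed

text \<open>A functional \<open>y\<close> on the columns is the row
  \<open>A\<^sup>T *\<^sub>v y\<close> of \<open>V\<close>, whose entries are the values of
  \<open>y\<close> on the columns. Cofactor functionals give \<open>slot\<close>, annihilators give
  \<open>P_eq_0\<close>.\<close>

lemma nonneg_space_of_represents:
  assumes V: "V \<in> Gr k n" and rep: "represents k n A V"
    and nonneg: "\<And>J. J \<subseteq> {..<n} \<Longrightarrow> card J = k \<Longrightarrow> 0 \<le> minor A J"
  shows "nonneg_space n k V (\<lambda>ps. cdet (map (col A) ps))"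
proof
  note V_eq = represents_eq(1)[OF rep]
  have A: "A \<in> carrier_mat k n" by (rule represents_eq(2)[OF rep])
  have AT: "A\<^sup>T \<in> carrier_mat n k" using A by simp
  show "V \<subseteq> carrier_vec n" unfolding V_eq using AT by auto
  show "V \<noteq> {}" unfolding V_eq by (auto intro: zero_carrier_vec)
  show "c \<cdot>\<^sub>v x + d \<cdot>\<^sub>v z \<in> V" if xz: "x \<in> V" "z \<in> V" for x z c d
  proof -
    obtain u w where uw: "x = A\<^sup>T *\<^sub>v u" "z = A\<^sup>T *\<^sub>v w" "u \<in> carrier_vec k" "w \<in> carrier_vec k"
      using xz unfolding V_eq by auto
    have "c \<cdot>\<^sub>v x + d \<cdot>\<^sub>v z = A\<^sup>T *\<^sub>v (c \<cdot>\<^sub>v u + d \<cdot>\<^sub>v w)"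
      unfolding uw using AT uw by (simp add: mult_add_distrib_mat_vec[OF AT] mult_mat_vec[OF AT])
    moreover have "c \<cdot>\<^sub>v u + d \<cdot>\<^sub>v w \<in> carrier_vec k" using uw by simp
    ultimately show ?thesis unfolding V_eq by blast
  qed
  show "\<exists>r \<in> V. \<forall>i < n. r $ i = cdet (map (col A) (xs @ [i] @ ys))" if "length xs + length ys + 1 = k" for xs ys
  proof -
    have N: "k = Suc (length (map (col A) xs) + length (map (col A) ys))" using that by simp
    obtain w where w: "w \<in> carrier_vec k"
      "\<And>x. x \<in> carrier_vec k \<Longrightarrow> cdet (map (col A) xs @ [x] @ map (col A) ys) = w \<bullet> x"
      using cdet_functional[OF N] by blast
    have "(A\<^sup>T *\<^sub>v w) $ i = cdet (map (col A) (xs @ [i] @ ys))" if "i < n" for i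
      using transpose_mult_vec_index[OF A w(1) that] w(2)[OF col_carrier[OF A], of i] by simp
    moreover have "A\<^sup>T *\<^sub>v w \<in> V" unfolding V_eq using w by auto
    ultimately show ?thesis by blast
  qed
  show "cdet (map (col A) ps) = 0" if "length ps = k" "\<not> distinct ps" for ps
  proof (rule cdet_not_distinct)
    show "\<not> distinct (map (col A) ps)" using that distinct_map by blast
    show "set (map (col A) ps) \<subseteq> carrier_vec (length (map (col A) ps))"
      using that col_carrier[OF A] by auto
  qed
  show "cdet (map (col A) (xs @ [v] @ ys)) = (-1) ^ length ys * cdet (map (col A) (xs @ ys @ [v]))"
    if "length xs + length ys + 1 = k" for xs v ys
    using cdet_move_to_end[of "map (col A) xs" "col A v" "map (col A) ys" k] that col_carrier[OF A] by auto
  show "0 \<le> cdet (map (col A) ps)" if "sorted ps" "distinct ps" "length ps = k" "set ps \<subseteq> {..<n}" for ps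
  proof -
    have "sorted_list_of_set (set ps) = ps" using that by (simp add: sorted_list_of_set.idem_if_sorted_distinct)
    moreover have "card (set ps) = k" using that distinct_card by metis
    ultimately show ?thesis using minor_eq_cdet[OF A that(4)] nonneg[OF that(4)] by simp
  qed
  show "\<exists>r \<in> V. (\<forall>t \<in> set ps. r $ t = 0) \<and> (\<exists>i < n. r $ i \<noteq> 0)"
    if ps: "length ps = k" "set ps \<subseteq> {..<n}" "cdet (map (col A) ps) = 0" for ps
  proof -
    have "set (map (col A) ps) \<subseteq> carrier_vec (length (map (col A) ps))"
      using ps col_carrier[OF A] by auto
    from cdet_eq_0_imp_annihilator[OF this ps(3)] obtain y where y: "y \<in> carrier_vec k" "y \<noteq> 0\<^sub>v k"
      "\<And>v. v \<in> set (map (col A) ps) \<Longrightarrow> y \<bullet> v = 0" using ps(1) by auto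
    have "A\<^sup>T *\<^sub>v y \<noteq> 0\<^sub>v n" using Gr_represents_inj[OF V rep y(1)] y(2) by blast
    moreover have "dim_vec (A\<^sup>T *\<^sub>v y) = n" using A by simp
    ultimately have "\<exists>i < n. (A\<^sup>T *\<^sub>v y) $ i \<noteq> 0" by (metis eq_vecI index_zero_vec)
    moreover have "(A\<^sup>T *\<^sub>v y) $ t = 0" if "t \<in> set ps" for t
      using transpose_mult_vec_index[OF A y(1), of t] y(3)[of "col A t"] that ps(2) by auto
    moreover have "A\<^sup>T *\<^sub>v y \<in> V" unfolding V_eq using y by auto
    ultimately show ?thesis by blast
  qed
qed

section \<open>First dependencies and the decorated permutation\<close>

lemma first_dep_props:
  assumes n: "1 \<le> n" and A: "A \<in> carrier_mat k n"
  shows "i \<le> first_dep k n A i" "first_dep k n A i \<le> i + n"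
    and "ccol n A i \<in> LinearCombinations.module.span class_ring (module_vec TYPE(real) k)
      (ccol n A ` {i<..first_dep k n A i})"
    and "\<lbrakk>i \<le> j; j < first_dep k n A i\<rbrakk> \<Longrightarrow> ccol n A i \<notin>
      LinearCombinations.module.span class_ring (module_vec TYPE(real) k) (ccol n A ` {i<..j})"
proof -
  interpret vec_space "TYPE(real)" k .
  let ?P = "\<lambda>j. i \<le> j \<and> ccol n A i \<in> span (ccol n A ` {i<..j})"
  have sub: "ccol n A ` {i<..i + n} \<subseteq> carrier_vec k" unfolding ccol_def using col_carrier[OF A] by auto
  have "ccol n A (i + n) \<in> ccol n A ` {i<..i + n}" using n by auto
  \<comment> \<open>By periodicity \<open>i + n\<close> always qualifies, so the minimum exists. At
    \<open>i = 0\<close> periodicity fails, since truncated subtraction gives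
    \<open>residue n 0 = 1\<close>.\<close>
  moreover have "ccol n A (i + n) = ccol n A i \<or> i = 0"
  proof (cases i)
    case (Suc m)
    thus ?thesis by (simp add: ccol_def residue_def)
  qed simp
  moreover have "ccol n A i \<in> ccol n A ` {i<..i + n}" if "i = 0"
    using that n by (auto simp: ccol_def residue_def intro!: image_eqI[of _ _ 1])
  ultimately have "?P (i + n)" using in_own_span[OF sub] by auto
  hence "?P (LEAST j. ?P j)" "(LEAST j. ?P j) \<le> i + n" by (rule LeastI, rule Least_le)
  thus "i \<le> first_dep k n A i" "first_dep k n A i \<le> i + n"
    "ccol n A i \<in> span (ccol n A ` {i<..first_dep k n A i})"
    unfolding first_dep_def by auto
  show "ccol n A i \<notin> span (ccol n A ` {i<..j})" if "i \<le> j" "j < first_dep k n A i"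
    using not_less_Least[of j ?P] that unfolding first_dep_def by auto
qed

lemma ccol_eq: "1 \<le> j \<Longrightarrow> j \<le> n \<Longrightarrow> ccol n A j = col A (j - 1)"
  unfolding ccol_def residue_def by simp

lemma ccol_image:
  assumes "w \<le> n"
  shows "ccol n A ` {i + 1<..w} = col A ` {i<..<w}"
proof -
  have "ccol n A ` {i + 1<..w} = (\<lambda>j. col A (j - 1)) ` {i + 1<..w}"
    using assms by (intro image_cong) (auto simp: ccol_eq)
  also have "\<dots> = col A ` (\<lambda>j. j - 1) ` {i + 1<..w}" by (simp add: image_image)
  also have "(\<lambda>j. j - 1) ` {i + 1<..w} = {i<..<w}"
  proof (intro equalityI subsetI)
    fix t assume "t \<in> {i<..<w}"
    thus "t \<in> (\<lambda>j. j - 1) ` {i + 1<..w}" by (intro image_eqI[of _ _ "t + 1"]) auto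
  qed auto
  finally show ?thesis .
qed

context
  fixes n k :: nat and A :: "real mat" and V :: "real vec set"
  assumes n: "1 \<le> n" and rep: "represents k n A V"
begin

lemma first_dep_start:
  assumes "first_dep k n A (i + 1) = w" "i < w" "w \<le> n" "r \<in> V" "\<forall>t \<in> {i<..<w}. r $ t = 0"
  shows "r $ i = 0"
proof -
  note A = represents_eq(2)[OF rep]
  obtain y where y: "r = A\<^sup>T *\<^sub>v y" "y \<in> carrier_vec k" using assms(4) represents_eq(1)[OF rep] by auto
  have "col A i \<in> LinearCombinations.module.span class_ring (module_vec TYPE(real) k) (col A ` {i<..<w})"
    using first_dep_props(3)[OF n A, of "i + 1"] assms(1-3) ccol_image[OF assms(3), of A i]
    by (simp add: ccol_eq)
  hence "y \<bullet> col A i = 0"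
  proof (rule span_annihilator[rotated 2])
    show "y \<bullet> s = 0" if "s \<in> col A ` {i<..<w}" for s
      using that assms(3,5) transpose_mult_vec_index[OF A y(2)] unfolding y(1) by auto
  qed (use col_carrier[OF A] y in auto)
  thus ?thesis using transpose_mult_vec_index[OF A y(2), of i] assms(2,3) unfolding y(1) by simp
qed

text \<open>By minimality of the first dependency, column \<open>w - 1\<close> is indispensable in
  it, so it can be exchanged for column \<open>i\<close>.\<close>

lemma first_dep_end:
  assumes "first_dep k n A (i + 1) = w" "i + 1 < w" "w \<le> n" "r \<in> V" "\<forall>t \<in> {i..<w - 1}. r $ t = 0"
  shows "r $ (w - 1) = 0"
proof -
  note A = represents_eq(2)[OF rep]
  obtain y where y: "r = A\<^sup>T *\<^sub>v y" "y \<in> carrier_vec k" using assms(4) represents_eq(1)[OF rep] by auto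
  have "{i<..<w} = insert (w - 1) {i<..<w - 1}" using assms(2) by auto
  hence ins: "col A ` {i<..<w} = insert (col A (w - 1)) (col A ` {i<..<w - 1})" by simp
  have zero: "y \<bullet> col A t = 0" if "i \<le> t" "t < w - 1" for t
    using that assms(3,5) transpose_mult_vec_index[OF A y(2), of t] unfolding y(1) by auto
  have "y \<bullet> col A (w - 1) = 0"
  proof (rule span_exchange_annihilator[where S = "col A ` {i<..<w - 1}" and v = "col A i"])
    show "col A i \<in> LinearCombinations.module.span class_ring (module_vec TYPE(real) k)
        (insert (col A (w - 1)) (col A ` {i<..<w - 1}))"
      using first_dep_props(3)[OF n A, of "i + 1"] assms(1-3) ccol_image[OF assms(3), of A i]
      unfolding ins by (simp add: ccol_eq)
    have "w - 1 \<le> n" using assms(3) by simp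
    from ccol_image[OF this, of A i]
    show "col A i \<notin> LinearCombinations.module.span class_ring (module_vec TYPE(real) k) (col A ` {i<..<w - 1})"
      using first_dep_props(4)[OF n A, of "i + 1" "w - 1"] assms(1-3) by (simp add: ccol_eq)
  qed (use col_carrier[OF A] y zero assms(2) in auto)
  thus ?thesis using transpose_mult_vec_index[OF A y(2), of "w - 1"] assms(2,3) unfolding y(1) by simp
qed

text \<open>A dependency that ends before \<open>i + 1 + n\<close> has not come round to column
  \<open>i\<close> again, so it involves other columns only.\<close>

lemma first_dep_no_coloop:
  assumes "first_dep k n A (i + 1) \<noteq> i + 1 + n" "i < n" "r \<in> V" "\<forall>t < n. t \<noteq> i \<longrightarrow> r $ t = 0"
  shows "r $ i = 0"
proof -
  note A = represents_eq(2)[OF rep]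
  obtain y where y: "r = A\<^sup>T *\<^sub>v y" "y \<in> carrier_vec k" using assms(3) represents_eq(1)[OF rep] by auto
  let ?d = "first_dep k n A (i + 1)"
  have d: "?d < i + 1 + n" using first_dep_props(2)[OF n A, of "i + 1"] assms(1) by simp
  have "y \<bullet> ccol n A (i + 1) = 0"
  proof (rule span_annihilator[OF _ y(2) first_dep_props(3)[OF n A, of "i + 1"]])
    show "ccol n A ` {i + 1<..?d} \<subseteq> carrier_vec k" unfolding ccol_def using col_carrier[OF A] by auto
    fix s assume "s \<in> ccol n A ` {i + 1<..?d}"
    then obtain j where j: "s = ccol n A j" "i + 1 < j" "j < i + 1 + n" using d by auto
    define t where "t = (j - 1) mod n"
    have "t < n" unfolding t_def using n by simp
    moreover have "t \<noteq> i"
    proof (cases "j - 1 < n")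
      case True
      thus ?thesis unfolding t_def using j by simp
    next
      case False
      hence "(j - 1) mod n = j - 1 - n" using j assms(2) by (simp add: mod_if)
      thus ?thesis unfolding t_def using j False by simp
    qed
    moreover have "s = col A t" using j unfolding ccol_def residue_def t_def by simp
    ultimately show "y \<bullet> s = 0"
      using assms(4) transpose_mult_vec_index[OF A y(2), of t] unfolding y(1) by auto
  qed
  thus ?thesis using transpose_mult_vec_index[OF A y(2), of i] assms(2) unfolding y(1) by (simp add: ccol_eq)
qed

text \<open>Without white fixed points the first dependency lies in a window of length
  \<open>n\<close> starting at \<open>i\<close>, where its residue determines it.\<close>

lemma first_dep_if_black_decoration:
  assumes dec: "dec_perm_mat k n A = black_decoration n p" and i: "i \<in> {1..n}"
  shows "first_dep k n A i \<noteq> i + n"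
    and "\<lbrakk>p i = w; i \<le> w; w \<le> n\<rbrakk> \<Longrightarrow> first_dep k n A i = w"
proof -
  note A = represents_eq(2)[OF rep]
  let ?d = "first_dep k n A i"
  have "snd (dec_perm_mat k n A) i \<noteq> Some White" unfolding dec black_decoration_def by simp
  thus ne: "?d \<noteq> i + n" using i n unfolding dec_perm_mat_def by (auto split: if_splits)
  show "?d = w" if "p i = w" "i \<le> w" "w \<le> n"
  proof -
    have "fst (dec_perm_mat k n A) i = w" unfolding dec black_decoration_def using that by simp
    hence res: "(?d - 1) mod n + 1 = w" using i unfolding dec_perm_mat_def residue_def by simp
    have d: "i \<le> ?d" "?d < i + n" using first_dep_props(1,2)[OF n A, of i] ne by auto
    show ?thesis
    proof (cases "?d - 1 < n")
      case True
      thus ?thesis using res d i by simp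
    next
      case False
      moreover have "?d - 1 - n < n" using d i False by auto
      ultimately have "(?d - 1) mod n = ?d - 1 - n" by (simp add: le_mod_geq)
      hence "?d = w + n" using res False n by simp
      thus ?thesis using d that by simp
    qed
  qed
qed

end

section \<open>From the cells to the theorem\<close>

lemma ex_represents:
  assumes "V \<in> Gr_nonneg k n"
  obtains A where "represents k n A V" "\<And>J. J \<subseteq> {..<n} \<Longrightarrow> card J = k \<Longrightarrow> 0 \<le> minor A J"
  using assms unfolding Gr_nonneg_def by auto

text \<open>Includes the single edge, so that all cells are indexed by sets \<open>B\<close> and
  distinct cells must have distinct sets.\<close>

definition caterpillar_cell :: "nat \<Rightarrow> nat \<Rightarrow> nat set \<Rightarrow> real vec set set" where
  "caterpillar_cell n k B = positroid_cell k n
     (black_decoration n (long_cycle n \<circ> trip_perm (if n = 2 then single_edge else caterpillar n B)))"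

lemma caterpillar_cell_fan_rows:
  assumes n: "3 \<le> n" and B: "B \<subseteq> {1..n - 2}" "card B = k" and V: "V \<in> caterpillar_cell n k B"
  shows "\<exists>r. fan_rows n B r \<and> V = row_combs n B r"
proof -
  let ?p = "long_cycle n \<circ> trip_perm (caterpillar n B)"
  define A where "A = (SOME A. represents k n A V)"
  have VG: "V \<in> Gr_nonneg k n" and dp: "dec_perm k n V = black_decoration n ?p"
    using V n unfolding caterpillar_cell_def positroid_cell_def by auto
  \<comment> \<open>\<open>A\<close> defines the permutation, \<open>A'\<close> has nonnegative
    minors, and the two may differ. Dependencies are therefore phrased through vectors of
    \<open>V\<close>, where both can be used.\<close>
  obtain A' where A': "represents k n A' V" "\<And>J. J \<subseteq> {..<n} \<Longrightarrow> card J = k \<Longrightarrow> 0 \<le> minor A' J"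
    using ex_represents[OF VG] by blast
  have rep: "represents k n A V" unfolding A_def using A'(1) by (rule someI)
  have dec: "dec_perm_mat k n A = black_decoration n ?p" using dp unfolding dec_perm_def A_def .
  have n1: "1 \<le> n" using n by simp
  have fd: "first_dep k n A (i + 1) = w"
    if "i < w" "w \<le> n - 1" "i \<notin> B" "w \<notin> B" "{i<..<w} \<subseteq> B" for i w
  proof (rule first_dep_if_black_decoration(2)[OF n1 rep dec])
    have "trip_perm (caterpillar n B) (i + 1) = w + 1"
      by (rule trip_perm_caterpillar) (use n that in auto)
    thus "?p (i + 1) = w" using long_cycle_Suc[of w n] that n by simp
  qed (use that n in auto)
  have VGr: "V \<in> Gr k n" using VG unfolding Gr_nonneg_def by simp
  interpret nonneg_space n k V "\<lambda>ps. cdet (map (col A') ps)"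
    by (rule nonneg_space_of_represents[OF VGr A'])
  have "{1..n - 2} = {1..<n - 1}" using n by auto
  interpret fan_dependencies n k V "\<lambda>ps. cdet (map (col A') ps)" B
  proof
    show "B \<subseteq> {1..<n - 1}" using B(1) \<open>{1..n - 2} = {1..<n - 1}\<close> by simp
    show "card B = k" by (rule B(2))
    show "r $ i = 0" if "i < w" "w \<le> n - 1" "i \<notin> B" "w \<notin> B" "{i<..<w} \<subseteq> B" "r \<in> V"
      "\<forall>t \<in> {i<..<w}. r $ t = 0" for i w r
      using first_dep_start[OF n1 rep fd[OF that(1-5)]] that by auto
    show "r $ (w - 1) = 0" if "i + 1 < w" "w \<le> n - 1" "i \<notin> B" "w \<notin> B" "{i<..<w} \<subseteq> B" "r \<in> V"
      "\<forall>t \<in> {i..<w - 1}. r $ t = 0" for i w r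
      using first_dep_end[OF n1 rep fd[of i w]] that by auto
    show "r $ i = 0" if "i < n" "r \<in> V" "\<forall>t < n. t \<noteq> i \<longrightarrow> r $ t = 0" for i r
      using first_dep_no_coloop[OF n1 rep first_dep_if_black_decoration(1)[OF n1 rep dec, of "i + 1"]] that
      by auto
  qed
  show ?thesis by (rule ex_fan_rows)
qed

lemma Gr_nonneg_0:
  assumes "V \<in> Gr_nonneg 0 n"
  shows "V = {0\<^sub>v n}"
proof -
  obtain A where A: "represents 0 n A V" using ex_represents[OF assms] by blast
  have AT: "A\<^sup>T \<in> carrier_mat n 0" using represents_eq(2)[OF A] by simp
  have *: "A\<^sup>T *\<^sub>v y = 0\<^sub>v n" if y: "y \<in> carrier_vec 0" for y
  proof (rule eq_vecI)
    fix i assume "i < dim_vec (0\<^sub>v n :: real vec)"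
    hence "(A\<^sup>T *\<^sub>v y) $ i = row A\<^sup>T i \<bullet> y" using AT by simp
    also have "\<dots> = 0" unfolding scalar_prod_def using y by simp
    finally show "(A\<^sup>T *\<^sub>v y) $ i = 0\<^sub>v n $ i" using \<open>i < dim_vec (0\<^sub>v n)\<close> by simp
  qed (use AT in simp)
  have "V = (\<lambda>y. A\<^sup>T *\<^sub>v y) ` carrier_vec 0" unfolding represents_eq(1)[OF A] by (rule Setcompr_eq_image)
  also have "\<dots> = (\<lambda>y :: real vec. 0\<^sub>v n) ` carrier_vec 0" by (intro image_cong refl) (rule *)
  also have "\<dots> = {0\<^sub>v n}" using zero_carrier_vec[of 0] by (rule image_constant)
  finally show ?thesis .
qed

text \<open>For \<open>n = 2\<close> there is no caterpillar, but then \<open>k = 0\<close> and the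
  only point is the zero space, the span of no rows.\<close>

lemma cells2_fan_rows:
  assumes "k + 2 \<le> n" "C \<in> cells2 n k"
  obtains B where "C = caterpillar_cell n k B" "card B = k"
    "\<And>V. V \<in> C \<Longrightarrow> \<exists>r. fan_rows n B r \<and> V = row_combs n B r"
proof (cases "n = 2")
  case True
  hence k: "k = 0" using assms by simp
  have C: "C = caterpillar_cell n k {}"
    using assms(2) True unfolding cells2_def Pi2_def G_tilde2_def caterpillar_cell_def by auto
  have "\<exists>r. fan_rows n {} r \<and> V = row_combs n {} r" if "V \<in> C" for V
  proof -
    have "V = {0\<^sub>v n}"
      using that k Gr_nonneg_0[of V n] unfolding C caterpillar_cell_def positroid_cell_def by simp
    moreover have "row_combs n {} r = {0\<^sub>v n}" for r unfolding row_combs_def by auto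
    ultimately show ?thesis unfolding fan_rows_def by auto
  qed
  thus ?thesis using that[of "{}"] C k by simp
next
  case False
  then obtain B where B: "B \<subseteq> {1..n - 2}" "card B = k" and C: "C = caterpillar_cell n k B"
    using assms(2) unfolding cells2_def Pi2_def G_tilde2_def caterpillar_cell_def by auto
  have "3 \<le> n" using assms False by simp
  from caterpillar_cell_fan_rows[OF this B] show ?thesis using that[OF C B(2)] unfolding C by blast
qed

theorem proposition4p12:
  fixes k n :: nat and Z :: "real mat"
  assumes "k + 2 \<le> n"
    and "Z \<in> Mat_pos (k + 2) n"
  shows "(\<forall>C \<in> cells2 n k. inj_on (Z_tilde Z) C \<and> Z_tilde Z ` C \<subseteq> amplituhedron n k 2 Z) \<and>
         disjoint_family_on (\<lambda>C. Z_tilde Z ` C) (cells2 n k)"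
proof (intro conjI ballI)
  note Z = assms(2)
  fix C assume C: "C \<in> cells2 n k"
  obtain B where B: "C = caterpillar_cell n k B" "card B = k"
    "\<And>V. V \<in> C \<Longrightarrow> \<exists>r. fan_rows n B r \<and> V = row_combs n B r"
    using cells2_fan_rows[OF assms(1) C] by blast
  show "inj_on (Z_tilde Z) C"
  proof (rule inj_onI)
    fix V V' assume V: "V \<in> C" "V' \<in> C" and eq: "Z_tilde Z V = Z_tilde Z V'"
    obtain r r' where r: "fan_rows n B r" "V = row_combs n B r" "fan_rows n B r'" "V' = row_combs n B r'"
      using B(3) V by metis
    have "V' \<subseteq> V" "V \<subseteq> V'"
      using row_combs_subset_if_images_eq[OF Z r(1) B(2) r(3)] row_combs_subset_if_images_eq[OF Z r(3) B(2) r(1)]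
        eq unfolding r(2,4) by auto
    thus "V = V'" by simp
  qed
  show "Z_tilde Z ` C \<subseteq> amplituhedron n k 2 Z"
    unfolding B(1) caterpillar_cell_def positroid_cell_def amplituhedron_def by auto
next
  note Z = assms(2)
  show "disjoint_family_on (\<lambda>C. Z_tilde Z ` C) (cells2 n k)"
    unfolding disjoint_family_on_def
  proof (intro ballI impI)
    fix C C' assume C: "C \<in> cells2 n k" "C' \<in> cells2 n k" "C \<noteq> C'"
    obtain B where B: "C = caterpillar_cell n k B" "card B = k"
      "\<And>V. V \<in> C \<Longrightarrow> \<exists>r. fan_rows n B r \<and> V = row_combs n B r"
      using cells2_fan_rows[OF assms(1) C(1)] by blast
    obtain B' where B': "C' = caterpillar_cell n k B'" "card B' = k"
      "\<And>V. V \<in> C' \<Longrightarrow> \<exists>r. fan_rows n B' r \<and> V = row_combs n B' r"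
      using cells2_fan_rows[OF assms(1) C(2)] by blast
    show "Z_tilde Z ` C \<inter> Z_tilde Z ` C' = {}"
    proof (rule ccontr)
      assume "Z_tilde Z ` C \<inter> Z_tilde Z ` C' \<noteq> {}"
      then obtain V V' where V: "V \<in> C" "V' \<in> C'" and eq: "Z_tilde Z V = Z_tilde Z V'" by auto
      obtain r r' where r: "fan_rows n B r" "V = row_combs n B r" "fan_rows n B' r'" "V' = row_combs n B' r'"
        using B(3) B'(3) V by metis
      have "B' \<subseteq> B" "B \<subseteq> B'"
        using fan_subset_if_images_eq[OF Z r(1) B(2) r(3)] fan_subset_if_images_eq[OF Z r(3) B'(2) r(1)] eq
        unfolding r(2,4) by auto
      thus False using C(3) B(1) B'(1) by simp
    qed
  qed
qed

end
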